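(* Let $T>0$ and let $\rho_0\in\mathcal{M}^{+}([0,1))$ and $\mu\in\mathcal{M}^{+}((0,T])$ have zero singular continuous parts. Then every Lagrangian solution with initial datum $\rho_0$ and influx $\mu$ is a measure-valued weak solution with initial condition $\rho_0$ and boundary condition $\mu$.
   Context: For an interval $I\subseteq\mathbb{R}$, $\mathcal{M}^{+}(I)$ denotes the set of nonnegative finite Borel measures on $I$. The velocity $\alpha\colon[0,\infty)\to(0,1]$ is a fixed strictly decreasing, Lipschitz continuous function with $\alpha(0)=1$. Semiflow: for $v\colon[0,T]\times[0,\infty)\to(0,1]$ integrable in the first variable and constant in the second variable, the semiflow of $v$ is the map $X\colon\{(t,r)\colon 0\le r\le t\le T\}\times[0,\infty)\to[0,\infty)$ such that for all $r\in[0,T]$ and $x_0\in[0,\infty)$: $X(r;r,x_0)=x_0$, $t\mapsto X(t;r,x_0)$ is absolutely continuous on $[r,T]$, and $\frac{\partial}{\partial t}X(t;r,x_0)=v(t,X(t;r,x_0))$ for almost every $t\in[r,T]$. Lagrangian solution: a function $\rho\colon[0,T]\to\mathcal{M}^{+}([0,1))$ is a Lagrangian solution with initial datum $\rho_0$ and influx $\mu$ if for every $t\in[0,T]$ and every Borel set $E\subseteq[0,1)$ $$\rho_t(E)=\int_{[0,1)}\chi_E(X(t;0,x_0))\,d\rho_0(x_0)+\int_{(0,t]}\chi_E(X(t;s,0))\,d\mu(s),$$ where $\chi_E$ is the indicator function of $E$ and $X$ is the semiflow of the vector field $v(t,x)=\alpha(W(t))$, $W(t)=\rho_t([0,1))$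 (with $W$ measurable). Test functions: $\Psi$ is the set of functions $\varphi\colon[0,T]\times[0,1]\to\mathbb{R}$ such that for every $t\in[0,T]$, $\varphi(t,1)=0$ and $\varphi(t,\cdot)$ is differentiable; $\partial_x\varphi$ is continuous jointly in $(t,x)$; and for every $x\in[0,1)$, $\varphi(\cdot,x)$ is Lipschitz continuous. Weak solution: a function $\rho\colon[0,T]\to\mathcal{M}^{+}([0,1))$ is a measure-valued weak solution with initial condition $\rho_0$ and boundary condition $\mu$ if $W\colon t\mapsto\rho_t([0,1))$ is integrable on $[0,T]$ and for every $\tau\in[0,T]$ and every $\varphi\in\Psi$ $$0=\int_{(0,\tau]}\int_{[0,1)}\bigl(\partial_t\varphi(t,x)+\alpha(W(t))\,\partial_x\varphi(t,x)\bigr)\,d\rho_t(x)\,dt+\int_{(0,\tau]}\varphi(t,0)\,d\mu(t)-\int_{[0,1)}\varphi(\tau,x)\,d\rho_\tau(x)+\int_{[0,1)}\varphi(0,x)\,d\rho_0(x).$$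
   Formalization: As the Lipschitz constant of φ(·,x) may depend on x, the double integral can fail to exist; the weak identity is asserted for each φ in Ψ and τ for which it converges absolutely, and this convergence is proved when the constant is uniform in x. *)

theory Defs
  imports "HOL-Analysis.Analysis"
begin

definition finite_borel_measures :: "real set \<Rightarrow> real measure set" where
  "finite_borel_measures I = {M. sets M = sets (restrict_space borel I) \<and> finite_measure M}"

text \<open>
  \<open>A\<close>, \<open>S\<close>, \<open>P\<close> are the absolutely continuous, the singular continuous and the pure point part
  of \<open>M\<close>. Lebesgue measure is restricted to the space of \<open>M\<close> because the measures
  live on an interval and not on all of \<open>\<real>\<close>.
\<close>

definition lebesgue_decomposition ::
    "real measure \<Rightarrow> real measure \<Rightarrow> real measure \<Rightarrow> real measure \<Rightarrow> bool" where
  "lebesgue_decomposition M A S P \<longleftrightarrow>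
     sets A = sets M \<and> sets S = sets M \<and> sets P = sets M \<and>
     (\<forall>E\<in>sets M. emeasure M E = emeasure A E + emeasure S E + emeasure P E) \<and>
     absolutely_continuous (restrict_space lborel (space M)) A \<and>
     (\<exists>N\<in>null_sets (restrict_space lborel (space M)). emeasure S (space M - N) = 0) \<and>
     (\<forall>x\<in>space M. emeasure S {x} = 0) \<and>
     (\<exists>C. countable C \<and> C \<subseteq> space M \<and> emeasure P (space M - C) = 0)"

text \<open>For a finite Borel measure the decomposition exists and is unique.\<close>

definition zero_singular_continuous_part :: "real measure \<Rightarrow> bool" where
  "zero_singular_continuous_part M \<longleftrightarrow>
     (\<exists>A S P. lebesgue_decomposition M A S P \<and> emeasure S (space M) = 0)"

definition absolutely_continuous_fun_on :: "real \<Rightarrow> real \<Rightarrow> (real \<Rightarrow> real) \<Rightarrow> bool" where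
  "absolutely_continuous_fun_on l r f \<longleftrightarrow>
     (\<forall>\<epsilon>>0. \<exists>\<delta>>0. \<forall>(n::nat) a b.
        (\<forall>i<n. l \<le> a i \<and> a i \<le> b i \<and> b i \<le> r) \<and>
        (\<forall>i<n. \<forall>j<n. i \<noteq> j \<longrightarrow> {a i<..<b i} \<inter> {a j<..<b j} = {}) \<and>
        (\<Sum>i<n. b i - a i) < \<delta>
        \<longrightarrow> (\<Sum>i<n. \<bar>f (b i) - f (a i)\<bar>) < \<epsilon>)"

text \<open>\<open>X t r x\<close> is \<open>X(t;r,x)\<close>; only its values for \<open>0 \<le> r \<le> t \<le> T\<close> and \<open>x \<ge> 0\<close> matter.\<close>

definition semiflow ::
    "real \<Rightarrow> (real \<Rightarrow> real \<Rightarrow> real) \<Rightarrow> (real \<Rightarrow> real \<Rightarrow> real \<Rightarrow> real) \<Rightarrow> bool" where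
  "semiflow T v X \<longleftrightarrow>
     (\<forall>r\<in>{0..T}. \<forall>x\<ge>0.
        (\<forall>t\<in>{r..T}. X t r x \<ge> 0) \<and>
        X r r x = x \<and>
        absolutely_continuous_fun_on r T (\<lambda>t. X t r x) \<and>
        (AE t in lebesgue_on {r..T}.
           ((\<lambda>s. X s r x) has_real_derivative v t (X t r x)) (at t within {r..T})))"

abbreviation total_mass :: "(real \<Rightarrow> real measure) \<Rightarrow> real \<Rightarrow> real" where
  "total_mass \<rho> t \<equiv> measure (\<rho> t) {0..<1}"

text \<open>
  The field \<open>v(t,x) = \<alpha>(W(t))\<close> does not depend on \<open>x\<close>, so its semiflow exists and is unique
  on the domain above; the existential quantifier merely names it.
\<close>

definition lagrangian_solution ::
    "(real \<Rightarrow> real) \<Rightarrow> real \<Rightarrow> real measure \<Rightarrow> real measure \<Rightarrow> (real \<Rightarrow> real measure) \<Rightarrow> bool" where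
  "lagrangian_solution \<alpha> T \<rho>0 \<mu> \<rho> \<longleftrightarrow>
     (\<forall>t\<in>{0..T}. \<rho> t \<in> finite_borel_measures {0..<1}) \<and>
     total_mass \<rho> \<in> borel_measurable (lebesgue_on {0..T}) \<and>
     (\<exists>X. semiflow T (\<lambda>t x. \<alpha> (total_mass \<rho> t)) X \<and>
        (\<forall>t\<in>{0..T}. \<forall>E\<in>sets borel. E \<subseteq> {0..<1} \<longrightarrow>
           measure (\<rho> t) E =
             (LINT x|\<rho>0. indicator E (X t 0 x)) + (LINT s:{0<..t}|\<mu>. indicator E (X t s 0))))"

definition partial_t :: "real \<Rightarrow> (real \<Rightarrow> real \<Rightarrow> real) \<Rightarrow> real \<Rightarrow> real \<Rightarrow> real" where
  "partial_t T \<phi> t x = vector_derivative (\<lambda>s. \<phi> s x) (at t within {0..T})"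

definition partial_x :: "(real \<Rightarrow> real \<Rightarrow> real) \<Rightarrow> real \<Rightarrow> real \<Rightarrow> real" where
  "partial_x \<phi> t x = vector_derivative (\<phi> t) (at x within {0..1})"

definition test_functions :: "real \<Rightarrow> (real \<Rightarrow> real \<Rightarrow> real) set" where
  "test_functions T = {\<phi>.
     (\<forall>t\<in>{0..T}. \<phi> t 1 = 0 \<and> \<phi> t differentiable_on {0..1}) \<and>
     continuous_on ({0..T} \<times> {0..1}) (\<lambda>(t, x). partial_x \<phi> t x) \<and>
     (\<forall>x\<in>{0..<1}. \<exists>L. L-lipschitz_on {0..T} (\<lambda>t. \<phi> t x))}"

definition transport_derivative ::
    "(real \<Rightarrow> real) \<Rightarrow> real \<Rightarrow> (real \<Rightarrow> real measure) \<Rightarrow> (real \<Rightarrow> real \<Rightarrow> real) \<Rightarrow> real \<Rightarrow> real \<Rightarrow> real" where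
  "transport_derivative \<alpha> T \<rho> \<phi> t x =
     partial_t T \<phi> t x + \<alpha> (total_mass \<rho> t) * partial_x \<phi> t x"

text \<open>
  Existence, as an absolutely convergent Lebesgue integral, of the double integral of \<open>f\<close> with
  respect to \<open>\<rho> t\<close> in the space variable and Lebesgue measure on \<open>{0<..\<tau>}\<close> in the time variable.
\<close>

definition double_integrable ::
    "real \<Rightarrow> (real \<Rightarrow> real measure) \<Rightarrow> (real \<Rightarrow> real \<Rightarrow> real) \<Rightarrow> bool" where
  "double_integrable \<tau> \<rho> f \<longleftrightarrow>
     (AE t in lebesgue_on {0<..\<tau>}. integrable (\<rho> t) (f t)) \<and>
     integrable (lebesgue_on {0<..\<tau>}) (\<lambda>t. LINT x|\<rho> t. f t x) \<and>
     integrable (lebesgue_on {0<..\<tau>}) (\<lambda>t. LINT x|\<rho> t. \<bar>f t x\<bar>)"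

text \<open>
  Test functions are Lipschitz in \<open>t\<close> for each \<open>x\<close>, with a constant that may be unbounded in \<open>x\<close>.
  The time derivative then exists almost everywhere along the solution, but it may fail to
  be integrable, for instance if
  \<open>\<phi>(t,x) = (\<Sum>n. h\<^sub>n * b((x - c\<^sub>n) / w\<^sub>n) * sin(N\<^sub>n * t))\<close> with bumps of disjoint supports,
  \<open>h\<^sub>n / w\<^sub>n \<longlonglongrightarrow> 0\<close> and rapidly growing \<open>N\<^sub>n\<close>. As integrals are total (with value \<open>0\<close> where they
  do not exist), what the weak identity says about its double integral is spelled out for each
  test function: the time derivative exists almost everywhere; the double integral exists if the
  Lipschitz constant can be chosen independently of \<open>x\<close>; and the identity holds whenever the
  double integral exists. The other three integrals always exist, since a test function
  is continuous and bounded on \<open>[0,T] \<times> [0,1]\<close>.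
\<close>

definition weak_solution ::
    "(real \<Rightarrow> real) \<Rightarrow> real \<Rightarrow> real measure \<Rightarrow> real measure \<Rightarrow> (real \<Rightarrow> real measure) \<Rightarrow> bool" where
  "weak_solution \<alpha> T \<rho>0 \<mu> \<rho> \<longleftrightarrow>
     (\<forall>t\<in>{0..T}. \<rho> t \<in> finite_borel_measures {0..<1}) \<and>
     integrable (lebesgue_on {0..T}) (total_mass \<rho>) \<and>
     (\<forall>\<tau>\<in>{0..T}. \<forall>\<phi>\<in>test_functions T.
        (AE t in lebesgue_on {0<..\<tau>}. AE x in \<rho> t.
           (\<lambda>s. \<phi> s x) differentiable (at t within {0..T})) \<and>
        ((\<exists>L. \<forall>x\<in>{0..<1}. L-lipschitz_on {0..T} (\<lambda>t. \<phi> t x)) \<longrightarrow>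
           double_integrable \<tau> \<rho> (transport_derivative \<alpha> T \<rho> \<phi>)) \<and>
        (double_integrable \<tau> \<rho> (transport_derivative \<alpha> T \<rho> \<phi>) \<longrightarrow>
           0 = (LINT t|lebesgue_on {0<..\<tau>}. (LINT x|\<rho> t.
                  partial_t T \<phi> t x + \<alpha> (total_mass \<rho> t) * partial_x \<phi> t x))
               + (LINT t:{0<..\<tau>}|\<mu>. \<phi> t 0)
               - (LINT x|\<rho> \<tau>. \<phi> \<tau> x)
               + (LINT x|\<rho>0. \<phi> 0 x)))"

end

theory Submission
  imports Defs
begin

text \<open>
  Put \<open>V t = \<alpha> (W t)\<close>. Since the velocity does not depend on space, every characteristic is a
  translate of \<open>Z t = X t 0 0\<close>. Label a particle by the constant \<open>c\<close> for which its position is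
  \<open>c + Z t\<close>: the initial particles have \<open>c = x\<close>, and a particle entering at time \<open>s\<close> has
  \<open>c = - Z s\<close>. With \<open>\<nu>\<close> the distribution of the labels, \<open>\<rho> t\<close> is the image of \<open>\<nu>\<close>
  restricted to \<open>0 \<le> c + Z t < 1\<close> under the shift by \<open>Z t\<close>, because \<open>Z\<close> is strictly increasing.

  Along a single trajectory, \<open>h t = \<phi> t (c + Z t)\<close> satisfies \<open>\<bar>h v - h t\<bar> \<le> K t * \<bar>v - t\<bar>\<close> with a constant
  that depends on \<open>t\<close> only through the position, so by Stepanov's theorem \<open>h\<close> is differentiable almost everywhere.
  Hence \<open>\<partial>\<^sub>t \<phi>\<close> exists at almost every point of the trajectory, and \<open>h\<close> is the Henstock--Kurzweil
  integral of its derivative. Integrating over \<open>\<nu>\<close> and applying Fubini's theorem yields the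
  weak formulation.
\<close>

section \<open>The sum of two measures\<close>

text \<open>The obstacle is the regularity of \<open>\<phi>\<close> in time: its Lipschitz constant
  depends on the position, with neither a bound nor measurability, so
  \<open>\<phi> t (c + Z t)\<close> is not known to be absolutely continuous. What survives is a
  finite constant \<open>K t\<close> at each time. This suits the gauge integral, whose gauge may
  depend on the tag and so absorbs an arbitrary \<open>K\<close> on a null set. Lebesgue
  integrability enters only through \<open>double_integrable\<close>; for almost every label both
  integrals then agree. Fubini's theorem also asks for joint measurability of the time derivative
  and of the set where it exists. It is obtained from the continuity of \<open>\<phi>\<close> by
  testing at rational times. A label determines its entrance time \<open>s\<close>:
  \<open>s = 0\<close> if \<open>c \<ge> 0\<close>, and \<open>c + Z s = 0\<close> otherwise. Hence
  one identity per label serves the initial mass and the influx alike. The speed stays above a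
  positive constant because the total mass never exceeds the mass of the data and
  \<open>\<alpha>\<close> is decreasing.\<close>

definition sum_measure :: "'a measure \<Rightarrow> 'a measure \<Rightarrow> 'a measure" where
  "sum_measure M N = measure_of (space M) (sets M) (\<lambda>A. emeasure M A + emeasure N A)"

lemma sets_sum_measure [simp, measurable_cong]: "sets (sum_measure M N) = sets M"
  by (simp add: sum_measure_def sets.sets_measure_of_eq)

lemma space_sum_measure [simp]: "space (sum_measure M N) = space M"
  by (rule sets_eq_imp_space_eq) simp

text \<open>The sum is used twice: it splits Lebesgue measure into the Stieltjes measures of
  \<open>f\<close> and of \<open>t - f t\<close>, and it joins the labels of the initial particles
  with those of the influx.\<close>

lemma emeasure_sum_measure:
  assumes "sets N = sets M" "A \<in> sets M"
  shows "emeasure (sum_measure M N) A = emeasure M A + emeasure N A"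
  unfolding sum_measure_def
proof (rule emeasure_measure_of_sigma)
  show "countably_additive (sets M) (\<lambda>A. emeasure M A + emeasure N A)"
  proof (rule countably_additiveI)
    fix F :: "nat \<Rightarrow> 'a set" assume F: "range F \<subseteq> sets M" "disjoint_family F"
    then have "(\<Sum>i. emeasure M (F i) + emeasure N (F i)) = (\<Sum>i. emeasure M (F i)) + (\<Sum>i. emeasure N (F i))"
      by (intro suminf_add[symmetric]) auto
    also have "\<dots> = emeasure M (\<Union>i. F i) + emeasure N (\<Union>i. F i)"
      using F assms by (simp add: suminf_emeasure)
    finally show "(\<Sum>i. emeasure M (F i) + emeasure N (F i)) = emeasure M (\<Union>i. F i) + emeasure N (\<Union>i. F i)" .
  qed
qed (use assms in \<open>auto simp: positive_def sets.sigma_algebra_axioms\<close>)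

lemma nn_integral_sum_measure:
  assumes [measurable_cong]: "sets N = sets M" and f: "f \<in> borel_measurable M"
  shows "(\<integral>\<^sup>+x. f x \<partial>sum_measure M N) = (\<integral>\<^sup>+x. f x \<partial>M) + (\<integral>\<^sup>+x. f x \<partial>N)"
  using f
proof (induction rule: borel_measurable_induct)
  case (cong f g)
  then have "(\<integral>\<^sup>+x. f x \<partial>P) = (\<integral>\<^sup>+x. g x \<partial>P)" if "space P = space M" for P
    using that by (intro nn_integral_cong) auto
  then show ?case using cong assms by (metis sets_eq_imp_space_eq space_sum_measure)
next
  case (set A)
  then show ?case using assms by (simp add: emeasure_sum_measure)
next
  case (mult u c)
  then have "u \<in> borel_measurable N" "u \<in> borel_measurable (sum_measure M N)" by simp_all
  with mult show ?case by (simp add: nn_integral_cmult distrib_left)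
next
  case (add u v)
  then have "u \<in> borel_measurable N" "v \<in> borel_measurable N" by simp_all
  with add show ?case by (simp add: nn_integral_add ac_simps)
next
  case (seq U)
  then have [measurable]: "\<And>i. U i \<in> borel_measurable M" by simp
  have [measurable]: "\<And>i. U i \<in> borel_measurable N" by simp
  have "(\<integral>\<^sup>+x. (SUP i. U i x) \<partial>sum_measure M N) = (SUP i. (\<integral>\<^sup>+x. U i x \<partial>sum_measure M N))"
    using seq by (intro nn_integral_monotone_convergence_SUP) auto
  also have "\<dots> = (SUP i. (\<integral>\<^sup>+x. U i x \<partial>M) + (\<integral>\<^sup>+x. U i x \<partial>N))"
    using seq by simp
  also have "\<dots> = (SUP i. (\<integral>\<^sup>+x. U i x \<partial>M)) + (SUP i. (\<integral>\<^sup>+x. U i x \<partial>N))"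
    using seq by (intro ennreal_SUP_add) (auto simp: mono_def le_fun_def intro!: incseq_nn_integral nn_integral_mono)
  also have "\<dots> = (\<integral>\<^sup>+x. (SUP i. U i x) \<partial>M) + (\<integral>\<^sup>+x. (SUP i. U i x) \<partial>N)"
    using seq by (simp add: nn_integral_monotone_convergence_SUP)
  finally show ?case by (simp add: image_image)
qed

text \<open>Positive and negative parts are integrated in \<open>ennreal\<close>. Integrability
  against the sum makes these integrals finite for both summands, which justifies the final
  subtraction.\<close>

lemma integral_sum_measure:
  fixes f :: "'a \<Rightarrow> real"
  assumes sets[measurable_cong]: "sets N = sets M" and f: "integrable (sum_measure M N) f"
  shows "(\<integral>x. f x \<partial>sum_measure M N) = (\<integral>x. f x \<partial>M) + (\<integral>x. f x \<partial>N)"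
proof -
  from f have [measurable]: "f \<in> borel_measurable M" by simp
  have eq: "(\<integral>\<^sup>+x. ennreal (g x) \<partial>sum_measure M N) = (\<integral>\<^sup>+x. ennreal (g x) \<partial>M) + (\<integral>\<^sup>+x. ennreal (g x) \<partial>N)"
    if "g \<in> borel_measurable M" for g :: "'a \<Rightarrow> real"
    using that by (intro nn_integral_sum_measure sets) simp
  have fin: "(\<integral>\<^sup>+x. ennreal (f x) \<partial>sum_measure M N) < \<infinity>" "(\<integral>\<^sup>+x. ennreal (- f x) \<partial>sum_measure M N) < \<infinity>"
    using f by (auto simp: real_integrable_def less_top)
  have M: "integrable M f" and N: "integrable N f"
    using fin unfolding real_integrable_def by (auto simp: eq)
  show "(\<integral>x. f x \<partial>sum_measure M N) = (\<integral>x. f x \<partial>M) + (\<integral>x. f x \<partial>N)"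
    using fin by (simp add: real_lebesgue_integral_def f M N eq enn2real_plus)
qed

lemma AE_sum_measureD:
  assumes sets[measurable_cong]: "sets N = sets M" and "AE x in sum_measure M N. P x"
  shows "AE x in M. P x" and "AE x in N. P x"
proof -
  obtain A where A: "A \<in> null_sets (sum_measure M N)" "{x \<in> space M. \<not> P x} \<subseteq> A"
    using assms by (auto simp: eventually_ae_filter)
  then have "emeasure M A + emeasure N A = 0" "A \<in> sets M"
    using emeasure_sum_measure[OF sets, of A] by (auto simp: null_sets_def)
  then have "A \<in> null_sets M" "A \<in> null_sets N" using sets by auto
  then show "AE x in M. P x" "AE x in N. P x"
    using A(2) sets_eq_imp_space_eq[OF sets] by (auto intro!: AE_I')
qed

section \<open>Differentiability almost everywhere\<close>

lemma continuous_on_slope: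
  fixes f :: "real \<Rightarrow> real"
  assumes mono: "\<And>x y. x \<le> y \<Longrightarrow> f x \<le> f y" and lip: "\<And>x y. x \<le> y \<Longrightarrow> f y - f x \<le> y - x"
  shows "continuous_on UNIV f"
proof (rule lipschitz_on_continuous_on, rule lipschitz_onI)
  show "dist (f x) (f y) \<le> 1 * dist x y" for x y
    using mono[of x y] mono[of y x] lip[of x y] lip[of y x] by (cases "x \<le> y") (auto simp: dist_real_def)
qed simp

text \<open>Vitali covering: up to a null set, \<open>E\<close> is covered by disjoint short
  intervals inside an open set barely larger than \<open>E\<close>, and on each of them the
  Stieltjes measure is at least \<open>q\<close> times the length.\<close>

lemma slope_interval_measure_bound:
  fixes f :: "real \<Rightarrow> real"
  assumes mono: "\<And>x y. x \<le> y \<Longrightarrow> f x \<le> f y" and lip: "\<And>x y. x \<le> y \<Longrightarrow> f y - f x \<le> y - x"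
    and E: "E \<in> sets borel"
    and small: "\<And>t d. t \<in> E \<Longrightarrow> 0 < d \<Longrightarrow> \<exists>u v. u < t \<and> t < v \<and> v - u < d \<and> q * (v - u) \<le> f v - f u"
    and ac: "\<And>A. A \<in> sets borel \<Longrightarrow> emeasure (interval_measure f) A \<le> emeasure lborel A"
  shows "ennreal q * emeasure lborel E \<le> emeasure (interval_measure f) E"
proof (cases "q \<le> 0")
  case True then show ?thesis by (simp add: ennreal_neg)
next
  case False
  define \<nu> where "\<nu> = interval_measure f"
  have [simp]: "sets \<nu> = sets borel" "space \<nu> = UNIV" by (simp_all add: \<nu>_def)
  have contf: "continuous_on UNIV f"
    by (rule continuous_on_slope[OF mono lip])
  have \<nu>: "emeasure \<nu> {u..v} = ennreal (f v - f u)" if "u \<le> v" for u v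
    unfolding \<nu>_def using that contf mono by (intro emeasure_interval_measure_Icc) (auto intro: continuous_on_subset)
  have "ennreal q * emeasure lborel E \<le> emeasure \<nu> E + ennreal e" if e0: "0 < e" for e :: real
  proof -
    obtain U where U: "open U" "E \<subseteq> U" "U - E \<in> lmeasurable" "emeasure lebesgue (U - E) < ennreal e"
      using sets_lebesgue_outer_open[OF _ e0, of E] E by (metis sets_completionI_sets sets_lborel)
    define K where "K = {(u,v). u < v \<and> {u..v} \<subseteq> U \<and> q * (v - u) \<le> f v - f u}"
    \<comment> \<open>Midpoint and radius: on the line, closed intervals are closed balls, as
      Vitali's theorem wants them. A ball has to contain the point it covers but need not be centred
      there.\<close>
    define c where "c = (\<lambda>(u::real,v). (u+v)/2)"
    define r where "r = (\<lambda>(u::real,v). (v-u)/2)"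
    have cb: "cball (c i) (r i) = {fst i..snd i}" for i
      by (auto simp: c_def r_def cball_eq_atLeastAtMost split_beta field_simps)
    obtain C where C: "countable C" "C \<subseteq> K"
       "pairwise (\<lambda>i j. disjnt (cball (c i) (r i)) (cball (c j) (r j))) C"
       "negligible (E - (\<Union>i\<in>C. cball (c i) (r i)))"
    proof (rule Vitali_covering_theorem_cballs[of K r E c])
      show "0 < r i" if "i \<in> K" for i using that by (auto simp: K_def r_def)
      fix x d :: real assume x: "x \<in> E" and "0 < d"
      then obtain e' where e': "e' > 0" "ball x e' \<subseteq> U" using U by (meson openE subsetD)
      obtain u v where uv: "u < x" "x < v" "v - u < min d e'" "q * (v - u) \<le> f v - f u"
        using small[OF x, of "min d e'"] \<open>0 < d\<close> e' by auto
      have "{u..v} \<subseteq> ball x e'" using uv by (auto simp: dist_real_def)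
      then have "(u,v) \<in> K" using uv e' by (auto simp: K_def)
      moreover have "x \<in> cball (c (u,v)) (r (u,v))" "r (u,v) < d" unfolding cb using uv by (auto simp: r_def)
      ultimately show "\<exists>i. i \<in> K \<and> x \<in> cball (c i) (r i) \<and> r i < d" by blast
    qed
    define I where "I = (\<lambda>i::real\<times>real. {fst i..snd i})"
    have disj: "disjoint_family_on I C" using C(3) unfolding cb I_def
      by (auto simp: pairwise_def disjoint_family_on_def disjnt_def)
    have IU: "(\<Union>i\<in>C. I i) \<in> sets borel" using C(1) by (auto simp: I_def)
    have "E - (\<Union>i\<in>C. I i) \<in> null_sets lborel"
      using C(4) E IU unfolding cb I_def negligible_iff_null_sets by (auto simp: null_sets_def)
    then have "emeasure lborel E \<le> emeasure lborel (\<Union>i\<in>C. I i)"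
      using E IU by (metis (no_types, lifting) Un_Diff_cancel2 Un_upper1 emeasure_Un_null_set emeasure_mono sets.Un sets_lborel sup_commute)
    also have "\<dots> = (\<integral>\<^sup>+i. emeasure lborel (I i) \<partial>count_space C)"
      using C(1) disj by (intro emeasure_UN_countable) (auto simp: I_def)
    finally have "ennreal q * emeasure lborel E \<le> ennreal q * (\<integral>\<^sup>+i. emeasure lborel (I i) \<partial>count_space C)"
      by (rule mult_left_mono) simp
    also have "\<dots> = (\<integral>\<^sup>+i. ennreal q * emeasure lborel (I i) \<partial>count_space C)"
      by (simp add: nn_integral_cmult)
    also have "\<dots> \<le> (\<integral>\<^sup>+i. emeasure \<nu> (I i) \<partial>count_space C)"
    proof (rule nn_integral_mono)
      fix i assume "i \<in> space (count_space C)"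
      then have "i \<in> K" using C by auto
      then show "ennreal q * emeasure lborel (I i) \<le> emeasure \<nu> (I i)"
        using False by (auto simp: K_def I_def \<nu> simp flip: ennreal_mult intro!: ennreal_leI)
    qed
    also have "\<dots> = emeasure \<nu> (\<Union>i\<in>C. I i)"
      using C(1) disj by (intro emeasure_UN_countable[symmetric]) (auto simp: I_def)
    also have "\<dots> \<le> emeasure \<nu> U"
      using C(2) U by (intro emeasure_mono) (force simp: K_def I_def subset_iff)+
    also have "\<dots> = emeasure \<nu> (E \<union> (U - E))"
      using U(2) by (simp add: Un_absorb1)
    also have "\<dots> \<le> emeasure \<nu> E + emeasure \<nu> (U - E)"
      using U E by (intro emeasure_subadditive) auto
    also have "\<dots> \<le> emeasure \<nu> E + ennreal e"
    proof (rule add_left_mono)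
      \<comment> \<open>Domination by Lebesgue measure makes the surplus \<open>U - E\<close> small
        for \<open>\<nu>\<close> too.\<close>
      have "emeasure \<nu> (U - E) \<le> emeasure lborel (U - E)"
        unfolding \<nu>_def using U E by (intro ac) auto
      also have "\<dots> \<le> ennreal e"
        using U E by (simp add: less_imp_le)
      finally show "emeasure \<nu> (U - E) \<le> ennreal e" .
    qed
    finally show ?thesis .
  qed
  then show ?thesis unfolding \<nu>_def by (rule ennreal_le_epsilon)
qed

text \<open>Open intervals determine Lebesgue measure, and the increments of \<open>f\<close> and
  \<open>t - f t\<close> add up to the length. The splitting also shows that each summand is
  dominated by Lebesgue measure.\<close>

lemma lborel_eq_sum_interval_measure:
  fixes f :: "real \<Rightarrow> real"
  assumes mono: "\<And>x y. x \<le> y \<Longrightarrow> f x \<le> f y" and lip: "\<And>x y. x \<le> y \<Longrightarrow> f y - f x \<le> y - x"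
    and contf: "continuous_on UNIV f"
  shows "lborel = sum_measure (interval_measure f) (interval_measure (\<lambda>t. t - f t))"
proof (rule lborel_eqI)
  fix l u :: real assume "\<And>b. b \<in> Basis \<Longrightarrow> l \<bullet> b \<le> u \<bullet> b"
  then have lu: "l \<le> u" by simp
  have box: "emeasure (interval_measure g) {l<..<u} = ennreal (g u - g l)"
    if g: "continuous_on UNIV g" "\<And>x y. x \<le> y \<Longrightarrow> g x \<le> g y" for g :: "real \<Rightarrow> real"
  proof -
    have Icc: "emeasure (interval_measure g) {x..y} = ennreal (g y - g x)" if "x \<le> y" for x y
      using that g by (intro emeasure_interval_measure_Icc) (auto intro: continuous_on_subset)
    have "{x} \<in> null_sets (interval_measure g)" for x
      using Icc[of x x] by (auto simp: null_sets_def)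
    then have "{l} \<union> {u} \<in> null_sets (interval_measure g)" by (intro null_sets.Un)
    then have "emeasure (interval_measure g) ({l..u} - ({l} \<union> {u})) = ennreal (g u - g l)"
      using lu by (subst emeasure_Diff_null_set) (auto simp: Icc)
    moreover have "{l..u} - ({l} \<union> {u}) = {l<..<u}" by auto
    ultimately show ?thesis by simp
  qed
  have "continuous_on UNIV (\<lambda>t. t - f t)" using contf by (intro continuous_intros)
  then show "emeasure (sum_measure (interval_measure f) (interval_measure (\<lambda>t. t - f t))) (box l u)
      = ennreal (\<Prod>b\<in>Basis. (u - l) \<bullet> b)"
    using lu mono[of l u] lip contf lip[of l u] mono
    by (simp add: emeasure_sum_measure box box_real flip: ennreal_plus) (simp add: box algebra_simps flip: ennreal_plus)
qed simp

text \<open>A steep chord with endpoint \<open>t\<close> remains steep when that endpoint is pushed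
  slightly past \<open>t\<close>. This makes \<open>t\<close> an interior point, so that the sets of
  steep points can be enclosed in countable intersections of open sets.\<close>

lemma steep_interval_if_steep_chords:
  fixes f :: "real \<Rightarrow> real"
  assumes contf: "continuous_on UNIV f" and freq: "\<exists>\<^sub>F s in at t. q < (f s - f t) / (s - t)" and "0 < d"
  shows "\<exists>u v. u < t \<and> t < v \<and> v - u < d \<and> q * (v - u) \<le> f v - f u"
proof -
  obtain s where s: "s \<noteq> t" "dist s t < d/2" "q < (f s - f t) / (s - t)"
    using freq \<open>0 < d\<close> unfolding frequently_at by (metis half_gt_zero)
  have "isCont (\<lambda>u. (f s - f u) / (s - u)) t"
    using contf s by (intro continuous_intros) (auto simp: continuous_on_eq_continuous_at)
  then have "\<forall>\<^sub>F u in at t. q < (f s - f u) / (s - u)"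
    using s by (simp add: isCont_def order_tendstoD(1))
  then obtain \<delta> where \<delta>: "\<delta> > 0" "\<And>u. u \<noteq> t \<Longrightarrow> dist u t < \<delta> \<Longrightarrow> q < (f s - f u) / (s - u)"
    by (auto simp: eventually_at)
  \<comment> \<open>Below \<open>\<delta>\<close> the chord keeps its slope; below
    \<open>d / 2\<close> the interval stays shorter than \<open>d\<close>, since \<open>s\<close> is
    within \<open>d / 2\<close> of \<open>t\<close>.\<close>
  define \<eta> where "\<eta> = min \<delta> d / 4"
  have \<eta>: "0 < \<eta>" "\<eta> < \<delta>" "\<eta> < d / 2" using \<delta> \<open>0 < d\<close> by (auto simp: \<eta>_def)
  show ?thesis
  proof (cases "t < s")
    case True
    then show ?thesis using \<delta>(2)[of "t - \<eta>"] \<eta> s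
      by (intro exI[of _ "t - \<eta>"] exI[of _ s]) (auto simp: dist_real_def field_simps)
  next
    case False
    then have "s < t" using s by simp
    then show ?thesis using \<delta>(2)[of "t + \<eta>"] \<eta> s
      by (intro exI[of _ s] exI[of _ "t + \<eta>"]) (auto simp: dist_real_def field_simps)
  qed
qed

text \<open>The limit is the upper limit \<open>Sup A\<close>: frequent values well below it would
  leave room for two rationals across which \<open>g\<close> oscillates. Rational thresholds keep
  the exceptional sets countable in number.\<close>

lemma tendsto_if_no_rational_oscillation:
  fixes g :: "'a \<Rightarrow> real"
  assumes F: "F \<noteq> bot" and bdd: "\<forall>\<^sub>F x in F. \<bar>g x\<bar> \<le> B"
    and osc: "\<And>p q. p \<in> \<rat> \<Longrightarrow> q \<in> \<rat> \<Longrightarrow> p < q \<Longrightarrow> \<not> ((\<exists>\<^sub>F x in F. g x < p) \<and> (\<exists>\<^sub>F x in F. q < g x))"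
  shows "\<exists>l. (g \<longlongrightarrow> l) F"
proof -
  define A where "A = {q. \<exists>\<^sub>F x in F. q < g x}"
  have "\<exists>\<^sub>F x in F. - B - 1 < g x"
    using F bdd by (intro eventually_frequently) (auto elim!: eventually_mono)
  then have "A \<noteq> {}" by (auto simp: A_def)
  have "q \<le> B" if "q \<in> A" for q
    using frequently_eventually_conj[of _ F, OF _ bdd] that frequently_ex[of _ F]
    unfolding A_def by fastforce
  then have "bdd_above A" by (rule bdd_aboveI)
  have "(g \<longlongrightarrow> Sup A) F"
  proof (rule order_tendstoI)
    fix a assume "a < Sup A"
    then obtain r where r: "r \<in> A" "a < r" using \<open>A \<noteq> {}\<close> \<open>bdd_above A\<close> less_cSup_iff by metis
    obtain p where p: "p \<in> \<rat>" "a < p" "p < r" using Rats_dense_in_real r by blast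
    obtain q where q: "q \<in> \<rat>" "p < q" "q < r" using Rats_dense_in_real p by blast
    have "\<exists>\<^sub>F x in F. q < g x" using r q unfolding A_def by (auto elim!: frequently_elim1)
    then have "\<forall>\<^sub>F x in F. \<not> g x < p" using osc[OF p(1) q(1,2)] by (simp add: not_frequently)
    then show "\<forall>\<^sub>F x in F. a < g x" using p by (auto elim!: eventually_mono)
  next
    fix a assume "Sup A < a"
    then obtain q where q: "Sup A < q" "q < a" using dense by blast
    then have "q \<notin> A" using \<open>bdd_above A\<close> cSup_upper by fastforce
    then have "\<forall>\<^sub>F x in F. \<not> q < g x" by (simp add: A_def not_frequently)
    then show "\<forall>\<^sub>F x in F. g x < a" using q by (auto elim!: eventually_mono)
  qed
  then show ?thesis by blast
qed

text \<open>
  The measures induced by \<open>f\<close> and by \<open>g t = t - f t\<close> add up to Lebesgue measure. Where the difference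
  quotients of \<open>f\<close> oscillate across \<open>{p..q}\<close>, they have densities at least \<open>q\<close> and \<open>1 - p\<close>,
  whose sum exceeds \<open>1\<close>.
\<close>

lemma negligible_nondifferentiable_slope:
  fixes f :: "real \<Rightarrow> real"
  assumes mono: "\<And>x y. x \<le> y \<Longrightarrow> f x \<le> f y" and lip: "\<And>x y. x \<le> y \<Longrightarrow> f y - f x \<le> y - x"
  shows "negligible {t. \<not> f differentiable (at t)}"
proof -
  define g where "g = (\<lambda>t. t - f t)"
  have contf: "continuous_on UNIV f"
    by (rule continuous_on_slope[OF mono lip])
  have contg: "continuous_on UNIV g" unfolding g_def using contf by (intro continuous_intros)
  have g: "x \<le> y \<Longrightarrow> g x \<le> g y" "x \<le> y \<Longrightarrow> g y - g x \<le> y - x" for x y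
    using mono[of x y] lip[of x y] by (auto simp: g_def)
  have sum: "emeasure lborel A = emeasure (interval_measure f) A + emeasure (interval_measure g) A"
    if "A \<in> sets borel" for A
    using that emeasure_sum_measure[of "interval_measure g" "interval_measure f" A]
      lborel_eq_sum_interval_measure[of f, OF mono lip contf] by (simp add: g_def)
  \<comment> \<open>A Borel superset of the points with chords steeper than \<open>q\<close> at all
    small scales: each union is open, and \<open>n\<close> runs through the scales.\<close>
  define S where "S = (\<lambda>f q. \<Inter>n::nat. \<Union>{{u<..<v} |u v. v - u < 1 / Suc n \<and> q * (v - u) \<le> f v - (f u :: real)})"
  have S_borel: "S h q \<in> sets borel" for h q
  proof -
    have "open (\<Union>{{u<..<v} |u v. v - u < 1 / Suc n \<and> q * (v - u) \<le> h v - h u})" for n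
      by (rule open_Union) auto
    then show ?thesis unfolding S_def by (intro sets.countable_INT) (blast intro: borel_open)+
  qed
  have S_small: "\<exists>u v. u < t \<and> t < v \<and> v - u < d \<and> q * (v - u) \<le> h v - h u" if t: "t \<in> S h q" and "0 < d" for t d h q
  proof -
    obtain n :: nat where n: "1 / Suc n < d" using \<open>0 < d\<close> nat_approx_posE by blast
    have "t \<in> \<Union>{{u<..<v} |u v. v - u < 1 / Suc n \<and> q * (v - u) \<le> h v - h u}" using t unfolding S_def by blast
    then obtain u v where "v - u < 1 / Suc n" "q * (v - u) \<le> h v - h u" "t \<in> {u<..<v}" by blast
    then show ?thesis using n by (intro exI[of _ u] exI[of _ v]) auto
  qed
  have S_I: "t \<in> S h q" if h: "continuous_on UNIV h" "\<exists>\<^sub>F s in at t. q < (h s - h t) / (s - t)" for t h q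
    unfolding S_def
  proof (intro INT_I)
    fix n
    obtain u v where "u < t" "t < v" "v - u < 1 / Suc n" "q * (v - u) \<le> h v - h u"
      using steep_interval_if_steep_chords[OF h, of "1 / Suc n"] by auto
    then show "t \<in> \<Union>{{u<..<v} |u v. v - u < 1 / Suc n \<and> q * (v - u) \<le> h v - h u}"
      by (intro UnionI[of "{u<..<v}"]) auto
  qed
  \<comment> \<open>The window \<open>{- real m..real m}\<close> makes the Lebesgue measure finite,
    so that it can be cancelled.\<close>
  define E where "E = (\<lambda>p q (m::nat). S f q \<inter> S g (1 - p) \<inter> {- real m..real m})"
  have null: "negligible (E p q m)" if "p < q" for p q m
  proof -
    have E: "E p q m \<in> sets borel" using S_borel by (auto simp: E_def)
    have "ennreal q * emeasure lborel (E p q m) + ennreal (1 - p) * emeasure lborel (E p q m)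
      \<le> emeasure (interval_measure f) (E p q m) + emeasure (interval_measure g) (E p q m)"
    proof (intro add_mono slope_interval_measure_bound)
      show "\<exists>u v. u < t \<and> t < v \<and> v - u < d \<and> q * (v - u) \<le> f v - f u"
        "\<exists>u v. u < t \<and> t < v \<and> v - u < d \<and> (1 - p) * (v - u) \<le> g v - g u"
        if "t \<in> E p q m" "0 < d" for t d
        using that S_small[of t _ _ d] by (auto simp: E_def)
    qed (use E in \<open>auto simp: sum mono lip g\<close>)
    also have "\<dots> = emeasure lborel (E p q m)" by (simp add: sum E)
    finally have le: "(ennreal q + ennreal (1 - p)) * emeasure lborel (E p q m) \<le> emeasure lborel (E p q m)"
      by (simp add: distrib_right)
    have fin: "emeasure lborel (E p q m) < \<infinity>"
      using E emeasure_mono[of "E p q m" "{- real m..real m}" lborel]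
      by (auto simp: E_def intro: le_less_trans)
    define x where "x = measure lborel (E p q m)"
    have x: "emeasure lborel (E p q m) = ennreal x" "0 \<le> x"
      using fin by (auto simp: x_def emeasure_eq_ennreal_measure less_top)
    \<comment> \<open>\<open>ennreal\<close> sends negative numbers to \<open>0\<close>, hence the
      two maxima; their sum is still at least \<open>q + (1 - p) > 1\<close>.\<close>
    define y where "y = max 0 q + max 0 (1 - p)"
    have y: "1 < y" using that by (auto simp: y_def max_def)
    have "ennreal q + ennreal (1 - p) = ennreal y"
      by (simp add: y_def max_def ennreal_neg flip: ennreal_plus)
    then have "y * x \<le> x" using le x y by (simp flip: ennreal_mult)
    then have "(y - 1) * x \<le> 0" by (simp add: algebra_simps)
    then have "x = 0" using x y by (auto simp: mult_le_0_iff)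
    then have "E p q m \<in> null_sets lborel" using E x by (auto simp: null_sets_def)
    then show ?thesis using negligible_iff_null_sets null_sets_completionI by blast
  qed
  have "{t. \<not> f differentiable (at t)} \<subseteq> (\<Union>(p,q)\<in>{(p,q). p \<in> \<rat> \<and> q \<in> \<rat> \<and> p < q}. \<Union>m. E p q m)"
  proof
    fix t assume "t \<in> {t. \<not> f differentiable (at t)}"
    then have nd: "\<not> (\<exists>l. ((\<lambda>s. (f s - f t) / (s - t)) \<longlongrightarrow> l) (at t))"
      by (simp add: real_differentiable_def has_field_derivative_iff)
    have slope: "0 \<le> (f s - f t) / (s - t) \<and> (f s - f t) / (s - t) \<le> 1" if "s \<noteq> t" for s
      using mono[of s t] mono[of t s] lip[of s t] lip[of t s] that
      by (cases "s < t") (auto simp: divide_simps)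
    have "\<forall>\<^sub>F s in at t. \<bar>(f s - f t) / (s - t)\<bar> \<le> 1"
      unfolding eventually_at_filter
    proof (intro always_eventually allI impI)
      fix s assume "s \<noteq> t"
      from slope[OF this] show "\<bar>(f s - f t) / (s - t)\<bar> \<le> 1" by linarith
    qed
    then obtain p q where pq: "p \<in> \<rat>" "q \<in> \<rat>" "p < q" "\<exists>\<^sub>F s in at t. (f s - f t) / (s - t) < p"
      "\<exists>\<^sub>F s in at t. q < (f s - f t) / (s - t)"
      using tendsto_if_no_rational_oscillation[of "at t" "\<lambda>s. (f s - f t) / (s - t)" 1] nd by auto
    have "\<exists>\<^sub>F s in at t. s \<noteq> t \<and> (f s - f t) / (s - t) < p"
      using frequently_eventually_conj[OF pq(4), of "\<lambda>s. s \<noteq> t"] by (auto simp: eventually_at_filter)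
    \<comment> \<open>The difference quotients of \<open>f\<close> and \<open>g\<close> add up to
      \<open>1\<close>, so flat chords of \<open>f\<close> are steep chords of
      \<open>g\<close>.\<close>
    then have "\<exists>\<^sub>F s in at t. 1 - p < (g s - g t) / (s - t)"
    proof (rule frequently_elim1)
      fix s assume s: "s \<noteq> t \<and> (f s - f t) / (s - t) < p"
      then have "(g s - g t) / (s - t) = 1 - (f s - f t) / (s - t)" by (auto simp: g_def diff_divide_distrib[symmetric] field_simps)
      then show "1 - p < (g s - g t) / (s - t)" using s by simp
    qed
    then have "t \<in> S f q" "t \<in> S g (1 - p)" using S_I contf contg pq by blast+
    moreover obtain m where "\<bar>t\<bar> \<le> real m" using real_arch_simple by blast
    ultimately have "t \<in> E p q m" by (auto simp: E_def)
    then show "t \<in> (\<Union>(p,q)\<in>{(p,q). p \<in> \<rat> \<and> q \<in> \<rat> \<and> p < q}. \<Union>m. E p q m)" using pq by blast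
  qed
  moreover have "countable {(p::real,q). p \<in> \<rat> \<and> q \<in> \<rat> \<and> p < q}"
    by (rule countable_subset[of _ "\<rat> \<times> \<rat>"]) (auto intro: countable_rat)
  ultimately show ?thesis
    by (elim negligible_subset[rotated], intro negligible_countable_Union)
      (auto intro!: negligible_Union_nat null)
qed

text \<open>Adding \<open>L * t\<close> brings all slopes between \<open>0\<close> and
  \<open>2 * L\<close>. Division by \<open>2 * L + 1\<close> then scales them into the unit
  interval, also when \<open>L = 0\<close>.\<close>

lemma negligible_nondifferentiable_lipschitz:
  fixes f :: "real \<Rightarrow> real"
  assumes "L-lipschitz_on UNIV f"
  shows "negligible {t. \<not> f differentiable (at t)}"
proof -
  have L: "0 \<le> L" "\<bar>f x - f y\<bar> \<le> L * \<bar>x - y\<bar>" for x y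
    using assms lipschitz_onD[OF assms, of x y] by (auto simp: lipschitz_on_def dist_real_def)
  define g where "g = (\<lambda>t. (f t + L * t) / (2 * L + 1))"
  have "negligible {t. \<not> g differentiable (at t)}"
  proof (rule negligible_nondifferentiable_slope)
    fix x y :: real assume "x \<le> y"
    then have "\<bar>f y - f x\<bar> \<le> L * (y - x)" using L(2)[of y x] by simp
    moreover have "g y - g x = (f y - f x + L * (y - x)) / (2 * L + 1)"
      by (simp add: g_def diff_divide_distrib[symmetric] algebra_simps)
    moreover from calculation L(1) \<open>x \<le> y\<close> have "f y - f x + L * (y - x) \<le> (y - x) * (2 * L + 1)"
      by (simp add: algebra_simps)
    ultimately have "0 \<le> g y - g x" "g y - g x \<le> y - x"
      using L(1) by (auto simp: pos_divide_le_eq)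
    then show "g x \<le> g y" "g y - g x \<le> y - x" by auto
  qed
  moreover have "f differentiable (at t)" if "g differentiable (at t)" for t
  proof -
    have "f = (\<lambda>t. (2 * L + 1) * g t - L * t)" using L by (auto simp: g_def)
    moreover have "(\<lambda>t. (2 * L + 1) * g t - L * t) differentiable (at t)"
      using that by (intro derivative_intros) auto
    ultimately show ?thesis by simp
  qed
  ultimately show ?thesis by (elim negligible_subset) auto
qed

text \<open>\<open>u - l\<close> has a local minimum at \<open>t\<close>, so both barriers have the
  same derivative there and trap the quotients of \<open>h\<close>.\<close>

lemma differentiable_squeeze:
  fixes l h u :: "real \<Rightarrow> real"
  assumes l: "l differentiable (at t)" and u: "u differentiable (at t)" and t: "t \<in> S" "l t = h t" "u t = h t"
    and le: "\<And>s. s \<in> S \<Longrightarrow> l s \<le> h s" "\<And>s. s \<in> S \<Longrightarrow> h s \<le> u s" and int: "t \<in> interior S"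
  shows "h differentiable (at t within S)"
proof -
  obtain a b where a: "(l has_real_derivative a) (at t)" and b: "(u has_real_derivative b) (at t)"
    using l u by (auto simp: real_differentiable_def)
  obtain d where d: "d > 0" "ball t d \<subseteq> S" using int mem_interior by blast
  have "((\<lambda>s. u s - l s) has_real_derivative (b - a)) (at t)" using a b by (intro derivative_intros)
  then have "b - a = 0"
    by (rule DERIV_local_min[OF _ d(1)]) (use le d t in \<open>force simp: dist_real_def\<close>)
  then have b: "(u has_real_derivative a) (at t)" using b by simp
  define q where "q = (\<lambda>f s. (f s - f t) / (s - t) :: real)"
  have q: "(q l \<longlongrightarrow> a) (at t)" "(q u \<longlongrightarrow> a) (at t)"
    using a b by (auto simp: has_field_derivative_iff q_def)
  have "(q h \<longlongrightarrow> a) (at t)"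
  proof (rule tendsto_sandwich)
    \<comment> \<open>To the left of \<open>t\<close>, division by \<open>s - t\<close> reverses the
      order of the quotients; minimum and maximum cover both sides.\<close>
    show "((\<lambda>s. min (q l s) (q u s)) \<longlongrightarrow> a) (at t)" using tendsto_min[OF q] by simp
    show "((\<lambda>s. max (q l s) (q u s)) \<longlongrightarrow> a) (at t)" using tendsto_max[OF q] by simp
    have "min (q l s) (q u s) \<le> q h s \<and> q h s \<le> max (q l s) (q u s)" if "s \<noteq> t" "dist s t < d" for s
    proof -
      have "l s \<le> h s" "h s \<le> u s" using le d that by (auto simp: dist_commute subset_iff)
      then show ?thesis
        using that t by (cases "s < t") (auto simp: q_def min_le_iff_disj le_max_iff_disj divide_simps)
    qed
    then show "\<forall>\<^sub>F s in at t. min (q l s) (q u s) \<le> q h s" "\<forall>\<^sub>F s in at t. q h s \<le> max (q l s) (q u s)"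
      using d(1) by (auto simp: eventually_at)
  qed
  then have "(h has_real_derivative a) (at t)"
    by (simp add: has_field_derivative_iff q_def)
  then show ?thesis using real_differentiable_def differentiable_at_withinI by blast
qed

text \<open>The witness is the infimal convolution of \<open>h\<close> with \<open>L\<close> times
  the distance, an infimum of \<open>L\<close>-Lipschitz functions kept finite by the lower bound
  \<open>B\<close>. At a point satisfying the last hypothesis, the infimum is attained at
  \<open>w = t\<close>.\<close>

lemma lipschitz_minorant:
  fixes h :: "real \<Rightarrow> real"
  assumes S: "S \<noteq> {}" "\<forall>w\<in>S. B \<le> h w" and L: "0 \<le> L"
  shows "\<exists>l. L-lipschitz_on UNIV l \<and> (\<forall>w\<in>S. l w \<le> h w) \<and>
    (\<forall>t\<in>S. (\<forall>w\<in>S. h t - h w \<le> L * \<bar>w - t\<bar>) \<longrightarrow> l t = h t)"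
proof (intro exI conjI ballI impI)
  define l where "l = (\<lambda>v. INF w\<in>S. h w + L * \<bar>v - w\<bar>)"
  have bdd: "bdd_below ((\<lambda>w. h w + L * \<bar>v - w\<bar>) ` S)" for v
    using S L by (intro bdd_belowI[of _ B]) (auto intro!: add_increasing2)
  have le: "l v \<le> l v' + L * \<bar>v - v'\<bar>" for v v'
  proof -
    have "l v - L * \<bar>v - v'\<bar> \<le> l v'"
      unfolding l_def
    proof (rule cINF_greatest[OF S(1)])
      fix w assume "w \<in> S"
      then have "(INF w\<in>S. h w + L * \<bar>v - w\<bar>) \<le> h w + L * \<bar>v - w\<bar>" by (intro cINF_lower bdd)
      moreover have "L * \<bar>v - w\<bar> \<le> L * \<bar>v - v'\<bar> + L * \<bar>v' - w\<bar>"
        unfolding distrib_left[symmetric] using L by (intro mult_left_mono) auto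
      ultimately show "(INF w\<in>S. h w + L * \<bar>v - w\<bar>) - L * \<bar>v - v'\<bar> \<le> h w + L * \<bar>v' - w\<bar>" by simp
    qed
    then show ?thesis by simp
  qed
  have "\<bar>l x - l y\<bar> \<le> L * \<bar>x - y\<bar>" for x y
    using le[of x y] le[of y x] by (simp add: abs_le_iff abs_minus_commute)
  then show "L-lipschitz_on UNIV l" using L by (intro lipschitz_onI) (auto simp: dist_real_def)
  show le: "l w \<le> h w" if "w \<in> S" for w
    using cINF_lower[OF bdd that, of w] by (simp add: l_def)
  show "l t = h t" if "t \<in> S" "\<forall>w\<in>S. h t - h w \<le> L * \<bar>w - t\<bar>" for t
  proof (rule antisym[OF le[OF that(1)]])
    show "h t \<le> l t" unfolding l_def using that(2)
      by (intro cINF_greatest[OF S(1)]) (simp add: abs_minus_commute algebra_simps)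
  qed
qed

text \<open>
  Stepanov's theorem in dimension one, by Maly's argument: on \<open>{t. K t \<le> n}\<close> the function is
  squeezed between its largest \<open>n\<close>-Lipschitz minorant and its least \<open>n\<close>-Lipschitz majorant.
\<close>

lemma negligible_nondifferentiable_pointwise_lipschitz:
  fixes h :: "real \<Rightarrow> real"
  assumes K: "\<And>t v. t \<in> {a..b} \<Longrightarrow> v \<in> {a..b} \<Longrightarrow> \<bar>h v - h t\<bar> \<le> K t * \<bar>v - t\<bar>"
  shows "negligible {t \<in> {a..b}. \<not> h differentiable (at t within {a..b})}"
proof (cases "a \<le> b")
  case True
  \<comment> \<open>The pointwise constant at the single point \<open>a\<close> already bounds
    \<open>h\<close> on the whole interval, as the infimal convolutions require.\<close>
  define B where "B = \<bar>h a\<bar> + \<bar>K a\<bar> * (b - a)"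
  have B: "\<bar>h w\<bar> \<le> B" if "w \<in> {a..b}" for w
  proof -
    have "\<bar>h w - h a\<bar> \<le> K a * (w - a)" using K[of a w] that by auto
    also have "\<dots> \<le> \<bar>K a\<bar> * (b - a)" using that by (intro mult_mono) auto
    finally show ?thesis by (auto simp: B_def)
  qed
  have ne: "{a..b} \<noteq> {}" "\<forall>w\<in>{a..b}. - B \<le> h w" "\<forall>w\<in>{a..b}. - B \<le> - h w"
    using True B unfolding abs_le_iff minus_le_iff[of B] by simp_all
  define P where "P = (\<lambda>n l u. n-lipschitz_on UNIV l \<and> n-lipschitz_on UNIV u \<and>
    (\<forall>w\<in>{a..b}. l w \<le> h w \<and> h w \<le> u w) \<and> (\<forall>t\<in>{a..b}. K t \<le> n \<longrightarrow> l t = h t \<and> u t = h t))"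
  have "\<exists>l u. P n l u" if "0 \<le> n" for n
  proof -
    have n: "\<bar>h v - h t\<bar> \<le> n * \<bar>v - t\<bar>" if "t \<in> {a..b}" "v \<in> {a..b}" "K t \<le> n" for t v
      using K[OF that(1,2)] that(3) by (meson abs_ge_zero mult_right_mono order_trans)
    obtain l where l: "n-lipschitz_on UNIV l" "\<forall>w\<in>{a..b}. l w \<le> h w"
      "\<forall>t\<in>{a..b}. (\<forall>w\<in>{a..b}. h t - h w \<le> n * \<bar>w - t\<bar>) \<longrightarrow> l t = h t"
      using lipschitz_minorant[OF ne(1,2) \<open>0 \<le> n\<close>] by blast
    \<comment> \<open>The majorant of \<open>h\<close> is the negative of a minorant of
      \<open>- h\<close>.\<close>
    obtain u where u: "n-lipschitz_on UNIV u" "\<forall>w\<in>{a..b}. u w \<le> - h w"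
      "\<forall>t\<in>{a..b}. (\<forall>w\<in>{a..b}. - h t - - h w \<le> n * \<bar>w - t\<bar>) \<longrightarrow> u t = - h t"
      using lipschitz_minorant[OF ne(1,3) \<open>0 \<le> n\<close>] by blast
    have "l t = h t \<and> - u t = h t" if "t \<in> {a..b}" "K t \<le> n" for t
    proof -
      have "h t - h w \<le> n * \<bar>w - t\<bar>" "- h t - - h w \<le> n * \<bar>w - t\<bar>" if "w \<in> {a..b}" for w
        using n[OF \<open>t \<in> {a..b}\<close> that \<open>K t \<le> n\<close>] by auto
      then show ?thesis using bspec[OF l(3) that(1)] bspec[OF u(3) that(1)] by simp
    qed
    moreover have "n-lipschitz_on UNIV (\<lambda>t. - u t)" using u(1) by (simp add: lipschitz_on_minus)
    moreover have "\<forall>w\<in>{a..b}. l w \<le> h w \<and> h w \<le> - u w"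
      using l(2) u(2) le_minus_iff by blast
    ultimately show ?thesis unfolding P_def using l(1)
      by (intro exI[of _ l] exI[of _ "\<lambda>t. - u t"]) simp
  qed
  then have "\<exists>l u. P (real n) l u" for n by simp
  then obtain l u where P: "\<And>n. P (real n) (l n) (u n)" by metis
  then have lu: "\<And>n::nat. (real n)-lipschitz_on UNIV (l n)" "\<And>n. (real n)-lipschitz_on UNIV (u n)"
    "\<And>n w. w \<in> {a..b} \<Longrightarrow> l n w \<le> h w" "\<And>n w. w \<in> {a..b} \<Longrightarrow> h w \<le> u n w"
    "\<And>n t. t \<in> {a..b} \<Longrightarrow> K t \<le> real n \<Longrightarrow> l n t = h t" "\<And>n t. t \<in> {a..b} \<Longrightarrow> K t \<le> real n \<Longrightarrow> u n t = h t"
    unfolding P_def by blast+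
  \<comment> \<open>Only the exceptional sets of countably many barriers are removed, so the levels
    of \<open>K\<close> may be nonmeasurable. The endpoints are added because squeezing takes place
    at an interior point.\<close>
  define N where "N = {a,b} \<union> (\<Union>n. {t. \<not> l n differentiable (at t)} \<union> {t. \<not> u n differentiable (at t)})"
  have "negligible (\<Union>n. {t. \<not> l n differentiable (at t)} \<union> {t. \<not> u n differentiable (at t)})"
    using lu(1,2) by (intro negligible_Union_nat negligible_Un negligible_nondifferentiable_lipschitz) auto
  then have "negligible N" unfolding N_def by (intro negligible_Un[of "{a,b}"]) (auto intro: negligible_finite)
  moreover have "{t \<in> {a..b}. \<not> h differentiable (at t within {a..b})} \<subseteq> N"
  proof (rule subsetI, rule ccontr)
    fix t assume t: "t \<in> {t \<in> {a..b}. \<not> h differentiable (at t within {a..b})}" "t \<notin> N"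
    obtain n where n: "K t \<le> real n" using real_arch_simple by blast
    have t': "l n differentiable (at t)" "u n differentiable (at t)" "t \<in> {a..b}" "t \<in> interior {a..b}"
      using t by (auto simp: N_def)
    have "h differentiable (at t within {a..b})"
      by (rule differentiable_squeeze[OF t'(1,2,3) lu(5)[OF t'(3) n] lu(6)[OF t'(3) n] lu(3,4) t'(4)])
    then show False using t by simp
  qed
  ultimately show ?thesis by (rule negligible_subset)
qed simp

section \<open>Integrating a derivative with an exceptional null set\<close>

text \<open>The exceptional set may be uncountable, provided that it contributes little to the increments of \<open>F\<close>.\<close>

lemma has_integral_derivative_exceptional_set:
  fixes F f :: "real \<Rightarrow> real"
  assumes ab: "a \<le> b"
    and der: "\<And>x. x \<in> {a..b} \<Longrightarrow> x \<notin> N \<Longrightarrow> (F has_real_derivative f x) (at x within {a..b})"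
    and N: "\<And>e. 0 < e \<Longrightarrow> \<exists>\<gamma>. gauge \<gamma> \<and> (\<forall>p. p tagged_division_of {a..b} \<and> \<gamma> fine p \<longrightarrow>
      (\<Sum>(x, K)\<in>{(x, K) \<in> p. x \<in> N}. \<bar>F (Sup K) - F (Inf K)\<bar>) \<le> e)"
  shows "((\<lambda>x. if x \<in> N then 0 else f x) has_integral (F b - F a)) {a..b}"
proof (cases "a = b")
  case False
  with ab have ab: "a < b" by simp
  show ?thesis
    unfolding has_integral_factor_content box_real[symmetric]
  proof safe
    fix e :: real
    assume "e > 0"
    then have e2: "0 < e / 2" by simp
    define P where "P = (\<lambda>x d. \<forall>y\<in>{a..b}. norm (y-x) < d \<longrightarrow> norm (F y - F x - (y-x) *\<^sub>R f x) \<le> e / 2 * norm (y-x))"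
    have "\<exists>d>0. x \<in> {a..b} - N \<longrightarrow> P x d" for x
    proof (cases "x \<in> {a..b} - N")
      case True
      then have "(F has_vector_derivative f x) (at x within {a..b})"
        using der by (simp add: has_real_derivative_iff_has_vector_derivative)
      then show ?thesis
        unfolding P_def has_vector_derivative_def has_derivative_within_alt using e2 by blast
    qed (auto intro: zero_less_one)
    then have "\<forall>x. \<exists>d>0. x \<in> {a..b} - N \<longrightarrow> P x d" by blast
    from choice[OF this]
    obtain d where d: "\<And>x. 0 < d x"
                   "\<And>x y. \<lbrakk>x \<in> {a..b} - N; y \<in> {a..b}; norm (y-x) < d x\<rbrakk>
                          \<Longrightarrow> norm (F y - F x - (y-x) *\<^sub>R f x) \<le> e / 2 * norm (y-x)"
      unfolding P_def by blast
    \<comment> \<open>Half of the tolerance \<open>e * (b - a)\<close> goes to the tags in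
      \<open>N\<close>, the other half to the straddle estimate at the remaining tags.\<close>
    define \<eta> where "\<eta> = e / 2 * (b - a)"
    have "\<eta> > 0" using \<open>e > 0\<close> ab by (simp add: \<eta>_def)
    then obtain \<gamma> where \<gamma>: "gauge \<gamma>" "\<And>p. p tagged_division_of {a..b} \<Longrightarrow> \<gamma> fine p \<Longrightarrow>
        (\<Sum>(x, K)\<in>{(x, K) \<in> p. x \<in> N}. \<bar>F (Sup K) - F (Inf K)\<bar>) \<le> \<eta>"
      using N by meson
    show "\<exists>d. gauge d \<and> (\<forall>p. p tagged_division_of (cbox a b) \<and> d fine p \<longrightarrow>
      norm ((\<Sum>(x, k)\<in>p. measure lborel k *\<^sub>R (if x \<in> N then 0 else f x)) - (F b - F a)) \<le> e * measure lborel (cbox a b))"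
    proof (rule exI, safe)
      show "gauge (\<lambda>x. ball x (d x) \<inter> \<gamma> x)"
        using d(1) \<gamma>(1) gauge_ball_dependent by (intro gauge_Int) blast+
    next
      fix p
      assume ptag: "p tagged_division_of cbox a b" and finep: "(\<lambda>x. ball x (d x) \<inter> \<gamma> x) fine p"
      have fin: "finite p" using ptag by blast
      have ba: "b - a = (\<Sum>(x,K)\<in>p. Sup K - Inf K)" "F b - F a = (\<Sum>(x,K)\<in>p. F(Sup K) - F(Inf K))"
        using additive_tagged_division_1[of a b p "\<lambda>x. x"] additive_tagged_division_1[of a b p F] ab ptag
        by simp_all
      define w where "w = (\<lambda>(x, K). if x \<in> N then \<bar>F (Sup K) - F (Inf K)\<bar> else 0)"
      have "norm (\<Sum>(x, K) \<in> p. (measure lborel K *\<^sub>R (if x \<in> N then 0 else f x)) - (F (Sup K) - F (Inf K)))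
            \<le> (\<Sum>n\<in>p. e / 2 * (case n of (x, k) \<Rightarrow> Sup k - Inf k) + w n)"
      proof (rule sum_norm_le,safe)
        fix x K
        assume xK: "(x, K) \<in> p"
        then obtain u v where k: "K = cbox u v" and "x \<in> K" and kab: "K \<subseteq> cbox a b"
          using ptag by (metis tagged_division_ofD(2,3,4))
        have "u \<le> v"
          using \<open>x \<in> K\<close> unfolding k by auto
        have ball: "\<forall>y\<in>K. y \<in> ball x (d x)"
          using fineD[OF finep xK] by blast
        have "u \<in> K" "v \<in> K"
          by (simp_all add: \<open>u \<le> v\<close> k)
        show "norm (measure lborel K *\<^sub>R (if x \<in> N then 0 else f x) - (F (Sup K) - F (Inf K))) \<le> e / 2 * (Sup K - Inf K) + w (x, K)"
        proof (cases "x \<in> N")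
          case True
          then show ?thesis using \<open>u \<le> v\<close> \<open>e > 0\<close> by (simp add: w_def k abs_minus_commute)
        next
          case False
          \<comment> \<open>Both endpoints are compared with the tangent at the tag. As
            \<open>x\<close> lies between them, their distances to it add up to
            \<open>v - u\<close>.\<close>
          have "norm ((v - u) *\<^sub>R f x - (F v - F u)) = norm (F u - F x - (u - x) *\<^sub>R f x - (F v - F x - (v - x) *\<^sub>R f x))"
            by (auto simp: algebra_simps)
          also have "\<dots> \<le> norm (F u - F x - (u - x) *\<^sub>R f x) + norm (F v - F x - (v - x) *\<^sub>R f x)"
            by (rule norm_triangle_ineq4)
          also have "\<dots> \<le> e / 2 * norm (u - x) + e / 2 * norm (v - x)"
          proof (intro add_mono d)
            show "norm (u - x) < d x" "norm (v - x) < d x"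
              using \<open>u \<in> K\<close> \<open>v \<in> K\<close> ball by (auto simp: dist_real_def)
          qed (use \<open>x \<in> K\<close> \<open>u \<in> K\<close> \<open>v \<in> K\<close> kab False in auto)
          also have "\<dots> = e / 2 * (Sup K - Inf K)"
            using \<open>x \<in> K\<close> by (auto simp: k interval_bounds_real[OF \<open>u \<le> v\<close>] field_simps)
          finally show ?thesis
            using \<open>u \<le> v\<close> False by (simp add: k w_def)
        qed
      qed
      also have "\<dots> = e / 2 * (b - a) + sum w p"
        by (simp add: sum.distrib ba sum_distrib_left)
      also have "sum w p = (\<Sum>(x, K)\<in>{(x, K) \<in> p. x \<in> N}. \<bar>F (Sup K) - F (Inf K)\<bar>)"
        unfolding w_def using fin by (intro sum.mono_neutral_cong_right) (auto split: if_splits)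
      also have "\<dots> \<le> \<eta>"
        using finep ptag by (intro \<gamma>) (auto simp: fine_Int)
      finally show "norm ((\<Sum>(x, K)\<in>p. measure lborel K *\<^sub>R (if x \<in> N then 0 else f x)) - (F b - F a)) \<le> e * measure lborel (cbox a b)"
        using ab by (simp add: ba split_def sum_subtractf[symmetric] \<eta>_def field_simps)
    qed
  qed
qed (simp add: has_integral_refl)

text \<open>The function equal to \<open>K\<close> on \<open>N\<close> and \<open>0\<close>
  elsewhere has gauge integral \<open>0\<close>, however wild \<open>K\<close> is; the sum is one of
  its Riemann sums.\<close>

lemma gauge_sum_over_negligible_tags:
  fixes K :: "real \<Rightarrow> real"
  assumes N: "negligible N" and e: "0 < e"
  shows "\<exists>\<gamma>. gauge \<gamma> \<and> (\<forall>p. p tagged_division_of {a..b} \<longrightarrow> \<gamma> fine p \<longrightarrow>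
      (\<Sum>(x, k)\<in>{(x, k) \<in> p. x \<in> N}. measure lborel k * K x) < e)"
proof -
  have "((\<lambda>x. if x \<in> N then K x else 0) has_integral 0) (cbox a b)"
    by (rule has_integral_negligible[OF N]) auto
  then obtain \<gamma> where \<gamma>: "gauge \<gamma>" "\<And>p. p tagged_division_of cbox a b \<Longrightarrow> \<gamma> fine p \<Longrightarrow>
      norm ((\<Sum>(x, k)\<in>p. measure lborel k *\<^sub>R (if x \<in> N then K x else 0)) - 0) < e"
    using e unfolding has_integral by metis
  show ?thesis
  proof (intro exI[of _ \<gamma>] conjI allI impI)
    fix p assume p: "p tagged_division_of {a..b}" "\<gamma> fine p"
    then have "finite p" by blast
    then have "(\<Sum>(x, k)\<in>{(x, k) \<in> p. x \<in> N}. measure lborel k * K x) = (\<Sum>(x, k)\<in>p. measure lborel k *\<^sub>R (if x \<in> N then K x else 0))"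
      by (intro sum.mono_neutral_cong_left) (auto split: if_splits)
    also have "\<dots> < e" using \<gamma>(2)[of p] p by (simp add: abs_less_iff)
    finally show "(\<Sum>(x, k)\<in>{(x, k) \<in> p. x \<in> N}. measure lborel k * K x) < e" .
  qed (fact \<gamma>(1))
qed

text \<open>An interval tagged at \<open>x\<close> in \<open>N\<close> contributes at most
  \<open>K x\<close> times its length, since its increment splits at the tag. A gauge adapted to
  \<open>K\<close> makes the total small without any bound on \<open>K\<close>.\<close>

lemma has_integral_derivative_pointwise_lipschitz:
  fixes F f K :: "real \<Rightarrow> real"
  assumes ab: "a \<le> b" and N: "negligible N"
    and der: "\<And>x. x \<in> {a..b} \<Longrightarrow> x \<notin> N \<Longrightarrow> (F has_real_derivative f x) (at x within {a..b})"
    and K: "\<And>t v. t \<in> {a..b} \<Longrightarrow> v \<in> {a..b} \<Longrightarrow> \<bar>F v - F t\<bar> \<le> K t * \<bar>v - t\<bar>"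
  shows "(f has_integral (F b - F a)) {a..b}"
proof (rule has_integral_spike[OF N])
  show "((\<lambda>x. if x \<in> N then 0 else f x) has_integral (F b - F a)) {a..b}"
  proof (rule has_integral_derivative_exceptional_set[OF ab der])
    fix e :: real assume "0 < e"
    then obtain \<gamma> where \<gamma>: "gauge \<gamma>" "\<And>p. p tagged_division_of {a..b} \<Longrightarrow> \<gamma> fine p \<Longrightarrow>
      (\<Sum>(x, k)\<in>{(x, k) \<in> p. x \<in> N}. measure lborel k * K x) < e"
      using gauge_sum_over_negligible_tags[OF N, of e a b K] by blast
    have "(\<Sum>(x, k)\<in>{(x, k) \<in> p. x \<in> N}. \<bar>F (Sup k) - F (Inf k)\<bar>) \<le> e"
      if p: "p tagged_division_of {a..b}" "\<gamma> fine p" for p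
    proof -
      have "(\<Sum>(x, k)\<in>{(x, k) \<in> p. x \<in> N}. \<bar>F (Sup k) - F (Inf k)\<bar>) \<le> (\<Sum>(x, k)\<in>{(x, k) \<in> p. x \<in> N}. measure lborel k * K x)"
      proof (rule sum_mono, safe)
        fix x k assume xk: "(x, k) \<in> p"
        then obtain u v where k: "k = {u..v}" and "x \<in> k" and kab: "k \<subseteq> {a..b}"
          using p(1) by (metis tagged_division_ofD(2,3,4) box_real(2))
        then have uv: "u \<le> v" "u \<in> {a..b}" "v \<in> {a..b}" "x \<in> {a..b}" "u \<le> x" "x \<le> v" by auto
        have "\<bar>F v - F u\<bar> \<le> \<bar>F v - F x\<bar> + \<bar>F u - F x\<bar>" by simp
        also have "\<dots> \<le> K x * \<bar>v - x\<bar> + K x * \<bar>u - x\<bar>" using uv by (intro add_mono K)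
        also have "\<dots> = (v - u) * K x" using uv by (simp add: algebra_simps)
        finally show "\<bar>F (Sup k) - F (Inf k)\<bar> \<le> measure lborel k * K x" using uv by (simp add: k)
      qed
      also have "\<dots> < e" using \<gamma>(2) p .
      finally show ?thesis by simp
    qed
    then show "\<exists>\<gamma>. gauge \<gamma> \<and> (\<forall>p. p tagged_division_of {a..b} \<and> \<gamma> fine p \<longrightarrow>
      (\<Sum>(x, K)\<in>{(x, K) \<in> p. x \<in> N}. \<bar>F (Sup K) - F (Inf K)\<bar>) \<le> e)"
      using \<gamma>(1) by blast
  qed
qed simp

text \<open>A gauge forces the intervals tagged in \<open>N\<close> to have total length below the
  \<open>\<delta>\<close> of absolute continuity, which bounds their increments. This version serves
  the characteristics, whose regularity is part of the notion of a semiflow.\<close>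

lemma has_integral_derivative_absolutely_continuous:
  fixes F f :: "real \<Rightarrow> real"
  assumes ab: "a \<le> b" and N: "negligible N"
    and der: "\<And>x. x \<in> {a..b} \<Longrightarrow> x \<notin> N \<Longrightarrow> (F has_real_derivative f x) (at x within {a..b})"
    and AC: "absolutely_continuous_fun_on a b F"
  shows "(f has_integral (F b - F a)) {a..b}"
proof (rule has_integral_spike[OF N])
  show "((\<lambda>x. if x \<in> N then 0 else f x) has_integral (F b - F a)) {a..b}"
  proof (rule has_integral_derivative_exceptional_set[OF ab der])
    fix e :: real assume "0 < e"
    define P where "P = (\<lambda>\<delta>. \<forall>(n::nat) l r.
        (\<forall>i<n. a \<le> l i \<and> l i \<le> r i \<and> r i \<le> b) \<and>
        (\<forall>i<n. \<forall>j<n. i \<noteq> j \<longrightarrow> {l i<..<r i} \<inter> {l j<..<r j} = {}) \<and>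
        (\<Sum>i<n. r i - l i) < \<delta> \<longrightarrow> (\<Sum>i<n. \<bar>F (r i) - F (l i)\<bar>) < e)"
    obtain \<delta> where \<delta>: "0 < \<delta>" "P \<delta>"
      using AC[unfolded absolutely_continuous_fun_on_def, rule_format, OF \<open>0 < e\<close>] unfolding P_def by iprover
    obtain \<gamma> where \<gamma>: "gauge \<gamma>" "\<And>p. p tagged_division_of {a..b} \<Longrightarrow> \<gamma> fine p \<Longrightarrow>
      (\<Sum>(x, k)\<in>{(x, k) \<in> p. x \<in> N}. measure lborel k * 1) < \<delta>"
      using gauge_sum_over_negligible_tags[OF N \<delta>(1), of a b "\<lambda>_. 1"] by blast
    have "(\<Sum>(x, k)\<in>{(x, k) \<in> p. x \<in> N}. \<bar>F (Sup k) - F (Inf k)\<bar>) \<le> e"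
      if p: "p tagged_division_of {a..b}" "\<gamma> fine p" for p
    proof -
      define q where "q = {(x, k) \<in> p. x \<in> N}"
      have "q \<subseteq> p" by (auto simp: q_def)
      moreover have "finite p" using p by blast
      ultimately have "finite q" by (rule finite_subset)
      \<comment> \<open>Absolute continuity speaks of indexed families, so the tagged intervals are
        enumerated.\<close>
      then obtain h where h: "bij_betw h {0..<card q} q" using ex_bij_betw_nat_finite by blast
      define l where "l = (\<lambda>i. Inf (snd (h i)))"
      define r where "r = (\<lambda>i. Sup (snd (h i)))"
      have hi: "h i \<in> p" if "i < card q" for i
        using h that \<open>q \<subseteq> p\<close> by (auto simp: bij_betw_def)
      have snd: "snd (h i) = {l i..r i}" "a \<le> l i" "l i \<le> r i" "r i \<le> b" if "i < card q" for i
      proof -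
        have "(fst (h i), snd (h i)) \<in> p" using hi[OF that] by simp
        then obtain u v where k: "snd (h i) = {u..v}" and "fst (h i) \<in> snd (h i)" and kab: "snd (h i) \<subseteq> {a..b}"
          using p(1) by (metis tagged_division_ofD(2,3,4) box_real(2))
        then have "u \<le> v" by auto
        then show "snd (h i) = {l i..r i}" "a \<le> l i" "l i \<le> r i" "r i \<le> b" using k kab by (auto simp: l_def r_def)
      qed
      have re: "(\<Sum>(x, k)\<in>q. g k) = (\<Sum>i<card q. g (snd (h i)))" for g :: "real set \<Rightarrow> real"
        using sum.reindex_bij_betw[OF h, of "\<lambda>(x, k). g k"] by (simp add: split_def atLeast0LessThan)
      have "(\<Sum>i<card q. \<bar>F (r i) - F (l i)\<bar>) < e"
      proof (rule \<delta>(2)[unfolded P_def, rule_format], intro conjI)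
        show "\<forall>i<card q. \<forall>j<card q. i \<noteq> j \<longrightarrow> {l i<..<r i} \<inter> {l j<..<r j} = {}"
        proof (intro allI impI)
          fix i j assume ij: "i < card q" "j < card q" "i \<noteq> j"
          then have "h i \<noteq> h j" using h by (auto simp: bij_betw_def inj_on_def)
          then have "interior (snd (h i)) \<inter> interior (snd (h j)) = {}"
            using tagged_division_ofD(5)[OF p(1), of "fst (h i)" "snd (h i)" "fst (h j)" "snd (h j)"] hi ij
            by (auto simp: prod_eq_iff)
          then show "{l i<..<r i} \<inter> {l j<..<r j} = {}" using snd ij by simp
        qed
        have "(\<Sum>i<card q. r i - l i) = (\<Sum>i<card q. measure lborel (snd (h i)))"
          using snd by (intro sum.cong) auto
        also have "\<dots> < \<delta>" using \<gamma>(2)[OF p] re[of "measure lborel"] by (simp add: q_def)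
        finally show "(\<Sum>i<card q. r i - l i) < \<delta>" .
      qed (use snd in simp)
      then show ?thesis using re[of "\<lambda>k. \<bar>F (Sup k) - F (Inf k)\<bar>"] by (simp add: q_def l_def r_def)
    qed
    then show "\<exists>\<gamma>. gauge \<gamma> \<and> (\<forall>p. p tagged_division_of {a..b} \<and> \<gamma> fine p \<longrightarrow>
      (\<Sum>(x, K)\<in>{(x, K) \<in> p. x \<in> N}. \<bar>F (Sup K) - F (Inf K)\<bar>) \<le> e)"
      using \<gamma>(1) by blast
  qed
qed simp

section \<open>Test functions along trajectories\<close>

locale test_function =
  fixes T :: real and \<phi> :: "real \<Rightarrow> real \<Rightarrow> real"
  assumes T_pos: "0 < T" and test: "\<phi> \<in> test_functions T"
begin

lemma has_derivative_x:
  assumes "t \<in> {0..T}" "x \<in> {0..1}"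
  shows "(\<phi> t has_real_derivative partial_x \<phi> t x) (at x within {0..1})"
proof -
  have "\<phi> t differentiable (at x within {0..1})"
    using test assms by (auto simp: test_functions_def differentiable_on_def)
  then show ?thesis
    by (simp add: vector_derivative_works partial_x_def has_real_derivative_iff_has_vector_derivative)
qed

lemma zero_right: "t \<in> {0..T} \<Longrightarrow> \<phi> t 1 = 0"
  using test by (auto simp: test_functions_def)

lemma continuous_partial_x: "continuous_on ({0..T} \<times> {0..1}) (\<lambda>(t, x). partial_x \<phi> t x)"
  using test by (auto simp: test_functions_def)

lemma lipschitz_t: "x \<in> {0..1} \<Longrightarrow> \<exists>L. L-lipschitz_on {0..T} (\<lambda>t. \<phi> t x)"
proof (cases "x = 1")
  case True
  then show ?thesis by (intro exI[of _ 0]) (auto simp: lipschitz_on_def zero_right)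
qed (use test in \<open>auto simp: test_functions_def\<close>)

text \<open>A bound for \<open>partial_x\<close>, available by compactness; it is a Lipschitz
  constant in space uniform in time.\<close>

definition C where "C = (SOME C. 0 \<le> C \<and> (\<forall>t\<in>{0..T}. \<forall>x\<in>{0..1}. \<bar>partial_x \<phi> t x\<bar> \<le> C))"

lemma C: "0 \<le> C" "t \<in> {0..T} \<Longrightarrow> x \<in> {0..1} \<Longrightarrow> \<bar>partial_x \<phi> t x\<bar> \<le> C"
proof -
  have "compact ((\<lambda>(t, x). partial_x \<phi> t x) ` ({0..T} \<times> {0..1}))"
    by (intro compact_continuous_image continuous_partial_x compact_Times) auto
  then obtain B where "0 < B" "\<forall>y\<in>(\<lambda>(t, x). partial_x \<phi> t x) ` ({0..T} \<times> {0..1}). norm y \<le> B"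
    using compact_imp_bounded bounded_pos by metis
  then have "0 \<le> B \<and> (\<forall>t\<in>{0..T}. \<forall>x\<in>{0..1}. \<bar>partial_x \<phi> t x\<bar> \<le> B)" by auto
  from someI[of "\<lambda>B. 0 \<le> B \<and> (\<forall>t\<in>{0..T}. \<forall>x\<in>{0..1}. \<bar>partial_x \<phi> t x\<bar> \<le> B)", OF this]
  show "0 \<le> C" "t \<in> {0..T} \<Longrightarrow> x \<in> {0..1} \<Longrightarrow> \<bar>partial_x \<phi> t x\<bar> \<le> C"
    unfolding C_def by blast+
qed

lemma lipschitz_x:
  assumes "t \<in> {0..T}" "x \<in> {0..1}" "y \<in> {0..1}"
  shows "\<bar>\<phi> t x - \<phi> t y\<bar> \<le> C * \<bar>x - y\<bar>"
  using field_differentiable_bound[of "{0..1}" "\<phi> t" "partial_x \<phi> t" C x y] assms C has_derivative_x by auto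

text \<open>The move in space is made first, at the new time, where the uniform constant
  \<open>C\<close> applies. The move in time is then made at the fixed position \<open>x\<close>, so
  that a single time constant \<open>L\<close> suffices.\<close>

lemma continuous: "continuous_on ({0..T} \<times> {0..1}) (\<lambda>(t, x). \<phi> t x)"
  unfolding continuous_on_iff
proof (intro ballI allI impI)
  fix z :: "real \<times> real" and e :: real
  assume z: "z \<in> {0..T} \<times> {0..1}" and e: "0 < e"
  obtain t x where z_eq: "z = (t, x)" by (cases z)
  with z have tx: "0 \<le> t" "t \<le> T" "0 \<le> x" "x \<le> 1" by auto
  obtain L where L: "L-lipschitz_on {0..T} (\<lambda>t. \<phi> t x)" using lipschitz_t[of x] tx by auto
  then have "0 \<le> L" by (rule lipschitz_on_nonneg)
  define d where "d = e / (L + C + 1)"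
  have "0 < d" using e \<open>0 \<le> L\<close> C(1) by (simp add: d_def)
  show "\<exists>d>0. \<forall>z'\<in>{0..T} \<times> {0..1}. dist z' z < d \<longrightarrow>
      dist ((\<lambda>(t, x). \<phi> t x) z') ((\<lambda>(t, x). \<phi> t x) z) < e"
  proof (intro exI[of _ d] conjI ballI impI)
    fix z' assume z': "z' \<in> {0..T} \<times> {0..1}" "dist z' z < d"
    obtain s y where z'_eq: "z' = (s, y)" by (cases z')
    with z' z_eq have sy: "0 \<le> s \<and> s \<le> T \<and> 0 \<le> y \<and> y \<le> 1" and d: "dist (s, y) (t, x) < d" by auto
    have "dist s t < d" "dist y x < d" using d dist_fst_le[of "(s,y)" "(t,x)"] dist_snd_le[of "(s,y)" "(t,x)"] by auto
    then have lt: "\<bar>s - t\<bar> < d" "\<bar>y - x\<bar> < d" by (auto simp: dist_real_def)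
    have "\<bar>\<phi> s y - \<phi> t x\<bar> \<le> \<bar>\<phi> s y - \<phi> s x\<bar> + \<bar>\<phi> s x - \<phi> t x\<bar>" by simp
    also have "\<dots> \<le> C * \<bar>y - x\<bar> + L * \<bar>s - t\<bar>"
      using lipschitz_onD[OF L, of s t] lipschitz_x[of s y x] sy tx by (intro add_mono) (auto simp: dist_real_def)
    also have "\<dots> \<le> C * d + L * d"
      using lt C(1) \<open>0 \<le> L\<close> by (intro add_mono mult_left_mono) auto
    also have "\<dots> < (L + C + 1) * d" using \<open>0 < d\<close> by (simp add: algebra_simps)
    also have "\<dots> = e" using C(1) \<open>0 \<le> L\<close> by (simp add: d_def)
    finally show "dist ((\<lambda>(t, x). \<phi> t x) z') ((\<lambda>(t, x). \<phi> t x) z) < e"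
      by (simp add: dist_real_def z_eq z'_eq)
  qed (fact \<open>0 < d\<close>)
qed

text \<open>Mean value inequality for \<open>\<phi> s\<close> minus the linear map with slope
  \<open>partial_x \<phi> t x\<close>. The error is uniform in the time \<open>s\<close> near
  \<open>t\<close>, as is required along a curve where time and position change together.\<close>

lemma strict_derivative_x:
  assumes tx: "t \<in> {0..T}" "x \<in> {0..1}" and e: "0 < e"
  obtains d where "0 < d" "\<And>s y. s \<in> {0..T} \<Longrightarrow> y \<in> {0..1} \<Longrightarrow> \<bar>s - t\<bar> < d \<Longrightarrow> \<bar>y - x\<bar> < d \<Longrightarrow>
    \<bar>\<phi> s y - \<phi> s x - partial_x \<phi> t x * (y - x)\<bar> \<le> e * \<bar>y - x\<bar>"
proof -
  obtain d where d: "0 < d" and dd: "\<And>z. z \<in> {0..T} \<times> {0..1} \<Longrightarrow> dist z (t, x) < d \<Longrightarrow>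
      dist ((\<lambda>(t, x). partial_x \<phi> t x) z) (partial_x \<phi> t x) < e"
    using continuous_partial_x[unfolded continuous_on_iff, rule_format, of "(t, x)" e] tx e by auto
  show thesis
  proof (rule that[of "d / 2"])
    fix s y assume sy: "s \<in> {0..T}" "y \<in> {0..1}" "\<bar>s - t\<bar> < d / 2" "\<bar>y - x\<bar> < d / 2"
    define g where "g = (\<lambda>z. \<phi> s z - partial_x \<phi> t x * z)"
    \<comment> \<open>A convex set containing \<open>x\<close> and \<open>y\<close> whose points are
      no farther from \<open>x\<close> than \<open>y\<close> is.\<close>
    define I where "I = {0..1} \<inter> cball x \<bar>y - x\<bar>"
    have "norm (g y - g x) \<le> e * norm (y - x)"
    proof (rule field_differentiable_bound[of I g "\<lambda>z. partial_x \<phi> s z - partial_x \<phi> t x * 1"])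
      show "convex I" by (auto simp: I_def intro!: convex_Int)
      show "x \<in> I" "y \<in> I" using tx sy by (auto simp: I_def dist_real_def)
      fix z assume z: "z \<in> I"
      have "(\<phi> s has_real_derivative partial_x \<phi> s z) (at z within I)"
        using z sy by (intro has_field_derivative_subset[OF has_derivative_x]) (auto simp: I_def)
      then show "(g has_real_derivative partial_x \<phi> s z - partial_x \<phi> t x * 1) (at z within I)"
        unfolding g_def by (auto intro!: derivative_eq_intros)
      have "dist (s, z) (t, x) \<le> dist s t + dist z x" by (simp add: dist_Pair_Pair sqrt_sum_squares_le_sum)
      also have "\<dots> < d" using sy z by (auto simp: I_def dist_real_def abs_minus_commute)
      finally show "norm (partial_x \<phi> s z - partial_x \<phi> t x * 1) \<le> e"
        using dd[of "(s, z)"] z sy by (auto simp: I_def dist_real_def)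
    qed
    then show "\<bar>\<phi> s y - \<phi> s x - partial_x \<phi> t x * (y - x)\<bar> \<le> e * \<bar>y - x\<bar>"
      by (simp add: g_def algebra_simps)
  qed (use d in simp)
qed

lemma derivative_along_curve:
  assumes Y: "\<And>s. s \<in> {0..T} \<Longrightarrow> Y s \<in> {0..1}" "t \<in> {0..T}"
    and der: "(Y has_real_derivative y) (at t within {0..T})"
  shows "((\<lambda>s. \<phi> s (Y s) - \<phi> s (Y t)) has_real_derivative y * partial_x \<phi> t (Y t)) (at t within {0..T})"
proof -
  define p where "p = partial_x \<phi> t (Y t)"
  \<comment> \<open>The value \<open>p\<close> where \<open>Y s = Y t\<close> makes the
    factorization of the quotient valid for every \<open>s\<close>, also if the curve returns to
    \<open>Y t\<close>.\<close>
  define q where "q = (\<lambda>s. if Y s = Y t then p else (\<phi> s (Y s) - \<phi> s (Y t)) / (Y s - Y t))"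
  have Yt: "Y t \<in> {0..1}" using Y by auto
  have "(Y \<longlongrightarrow> Y t) (at t within {0..T})"
    using DERIV_continuous[OF der] by (simp add: continuous_within)
  then have Yc: "\<forall>\<^sub>F s in at t within {0..T}. \<bar>Y s - Y t\<bar> < d" if "0 < d" for d
    using that by (auto simp: tendsto_iff dist_real_def)
  have "(q \<longlongrightarrow> p) (at t within {0..T})"
  proof (rule tendstoI)
    fix e :: real assume "0 < e"
    then obtain d where d: "0 < d" "\<And>s y. s \<in> {0..T} \<Longrightarrow> y \<in> {0..1} \<Longrightarrow> \<bar>s - t\<bar> < d \<Longrightarrow> \<bar>y - Y t\<bar> < d \<Longrightarrow>
        \<bar>\<phi> s y - \<phi> s (Y t) - p * (y - Y t)\<bar> \<le> e / 2 * \<bar>y - Y t\<bar>"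
      using strict_derivative_x[OF Y(2) Yt, of "e / 2"] unfolding p_def by (metis half_gt_zero)
    have "\<forall>\<^sub>F s in at t within {0..T}. s \<in> {0..T} \<and> \<bar>s - t\<bar> < d"
      using d(1) by (auto simp: eventually_at dist_real_def)
    with Yc[OF d(1)] show "\<forall>\<^sub>F s in at t within {0..T}. dist (q s) p < e"
    proof eventually_elim
      case (elim s)
      show ?case
      proof (cases "Y s = Y t")
        case False
        have "\<bar>\<phi> s (Y s) - \<phi> s (Y t) - p * (Y s - Y t)\<bar> \<le> e / 2 * \<bar>Y s - Y t\<bar>"
          using d(2) elim Y(1) by blast
        moreover have "q s - p = (\<phi> s (Y s) - \<phi> s (Y t) - p * (Y s - Y t)) / (Y s - Y t)"
          using False by (simp add: q_def field_simps)
        ultimately have "\<bar>q s - p\<bar> \<le> e / 2" using False by (simp add: abs_divide pos_divide_le_eq)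
        then show ?thesis using \<open>0 < e\<close> by (simp add: dist_real_def)
      qed (use \<open>0 < e\<close> in \<open>simp add: q_def\<close>)
    qed
  qed
  then have "((\<lambda>s. (Y s - Y t) / (s - t) * q s) \<longlongrightarrow> y * p) (at t within {0..T})"
    using der by (intro tendsto_mult) (auto simp: has_field_derivative_iff)
  moreover have "(Y s - Y t) / (s - t) * q s = (\<phi> s (Y s) - \<phi> s (Y t)) / (s - t)" for s
    by (simp add: q_def)
  ultimately show ?thesis by (simp add: has_field_derivative_iff p_def del: times_divide_eq_left)
qed

text \<open>Compare through \<open>\<phi> v (Y t)\<close>: the change in space costs
  \<open>C\<close>, and the change in time is taken at position \<open>Y t\<close>. The constant
  thus depends on \<open>t\<close> but not on \<open>v\<close>.\<close>

lemma pointwise_lipschitz_along_curve: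
  assumes Y: "\<And>s. s \<in> {0..T} \<Longrightarrow> Y s \<in> {0..1}"
    and lip: "\<And>s t. s \<in> {0..T} \<Longrightarrow> t \<in> {0..T} \<Longrightarrow> \<bar>Y s - Y t\<bar> \<le> \<bar>s - t\<bar>"
  shows "\<exists>K. \<forall>t\<in>{0..T}. \<forall>v\<in>{0..T}. \<bar>\<phi> v (Y v) - \<phi> t (Y t)\<bar> \<le> K t * \<bar>v - t\<bar>"
proof -
  have "\<forall>x\<in>{0..1}. \<exists>L. L-lipschitz_on {0..T} (\<lambda>t. \<phi> t x)" using lipschitz_t by blast
  from bchoice[OF this] obtain L where L: "\<forall>x\<in>{0..1}. (L x)-lipschitz_on {0..T} (\<lambda>t. \<phi> t x)" by blast
  show ?thesis
  proof (intro exI[of _ "\<lambda>t. C + L (Y t)"] ballI)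
    fix t v assume tv: "t \<in> {0..T}" "v \<in> {0..T}"
    have "\<bar>\<phi> v (Y v) - \<phi> t (Y t)\<bar> \<le> \<bar>\<phi> v (Y v) - \<phi> v (Y t)\<bar> + \<bar>\<phi> v (Y t) - \<phi> t (Y t)\<bar>" by simp
    also have "\<dots> \<le> C * \<bar>Y v - Y t\<bar> + L (Y t) * \<bar>v - t\<bar>"
      using lipschitz_onD[OF L[rule_format], of "Y t" v t] lipschitz_x[of v "Y v" "Y t"] Y tv
      by (intro add_mono) (auto simp: dist_real_def)
    also have "\<dots> \<le> C * \<bar>v - t\<bar> + L (Y t) * \<bar>v - t\<bar>"
      using lip tv C(1) by (intro add_right_mono mult_left_mono) auto
    finally show "\<bar>\<phi> v (Y v) - \<phi> t (Y t)\<bar> \<le> (C + L (Y t)) * \<bar>v - t\<bar>" by (simp add: distrib_right)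
  qed
qed

lemma partial_t_eqI:
  assumes "((\<lambda>s. \<phi> s x) has_real_derivative D) (at t within {0..T})" "t \<in> {0..T}"
  shows "partial_t T \<phi> t x = D"
  unfolding partial_t_def using assms T_pos
  by (intro vector_derivative_within_closed_interval) (auto simp: has_real_derivative_iff_has_vector_derivative)

lemma partial_t_works:
  assumes "(\<lambda>s. \<phi> s x) differentiable (at t within {0..T})"
  shows "((\<lambda>s. \<phi> s x) has_real_derivative partial_t T \<phi> t x) (at t within {0..T})"
  using assms by (simp add: vector_derivative_works partial_t_def has_real_derivative_iff_has_vector_derivative)

lemma partial_t_bound:
  assumes L: "L-lipschitz_on {0..T} (\<lambda>t. \<phi> t x)" and t: "t \<in> {0..T}"
    and "(\<lambda>s. \<phi> s x) differentiable (at t within {0..T})"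
  shows "\<bar>partial_t T \<phi> t x\<bar> \<le> L"
proof (rule tendsto_upperbound)
  show "((\<lambda>s. \<bar>(\<phi> s x - \<phi> t x) / (s - t)\<bar>) \<longlongrightarrow> \<bar>partial_t T \<phi> t x\<bar>) (at t within {0..T})"
    using partial_t_works[OF assms(3)] by (intro tendsto_rabs) (simp add: has_field_derivative_iff)
  have "\<bar>(\<phi> s x - \<phi> t x) / (s - t)\<bar> \<le> L" if "s \<in> {0..T}" "s \<noteq> t" for s
    using lipschitz_onD[OF L that(1) t] that(2) by (simp add: dist_real_def abs_divide pos_divide_le_eq)
  then show "\<forall>\<^sub>F s in at t within {0..T}. \<bar>(\<phi> s x - \<phi> t x) / (s - t)\<bar> \<le> L"
    by (auto simp: eventually_at_filter)
  show "at t within {0..T} \<noteq> bot" using t T_pos by (simp add: trivial_limit_within)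
qed

end

section \<open>The flow of a velocity that is constant in space\<close>

locale transport_flow =
  fixes T :: real and Z V :: "real \<Rightarrow> real" and c0 :: real and N :: "real set"
  assumes Z0: "Z 0 = 0" and c0: "0 < c0"
    and Z_lower: "\<And>s t. 0 \<le> s \<Longrightarrow> s \<le> t \<Longrightarrow> t \<le> T \<Longrightarrow> c0 * (t - s) \<le> Z t - Z s"
    and Z_upper: "\<And>s t. 0 \<le> s \<Longrightarrow> s \<le> t \<Longrightarrow> t \<le> T \<Longrightarrow> Z t - Z s \<le> t - s"
    and N: "negligible N"
    and Z_deriv: "\<And>t. t \<in> {0..T} \<Longrightarrow> t \<notin> N \<Longrightarrow> (Z has_real_derivative V t) (at t within {0..T})"
begin

lemma Z_strict_mono:
  assumes "0 \<le> s" "s < t" "t \<le> T"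
  shows "Z s < Z t"
proof -
  have "0 < c0 * (t - s)" using c0 assms by simp
  then show ?thesis using Z_lower[of s t] assms by linarith
qed

lemma Z_mono: "0 \<le> s \<Longrightarrow> s \<le> t \<Longrightarrow> t \<le> T \<Longrightarrow> Z s \<le> Z t"
  using Z_strict_mono by (cases "s = t") (auto simp: less_le)

lemma Z_le_iff: "s \<in> {0..T} \<Longrightarrow> t \<in> {0..T} \<Longrightarrow> Z s \<le> Z t \<longleftrightarrow> s \<le> t"
  using Z_strict_mono[of t s] Z_mono[of s t] by force

lemma Z_lipschitz: "s \<in> {0..T} \<Longrightarrow> t \<in> {0..T} \<Longrightarrow> \<bar>Z s - Z t\<bar> \<le> \<bar>s - t\<bar>"
  using Z_upper[of s t] Z_upper[of t s] Z_mono[of s t] Z_mono[of t s] by (cases "s \<le> t") auto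

text \<open>By strict monotonicity a trajectory meets a level at most once; the times spent at the
  boundary points \<open>0\<close> and \<open>1\<close> can be discarded.\<close>

lemma negligible_level: "negligible {t \<in> {0..T}. c + Z t = x}"
proof (cases "\<exists>t\<in>{0..T}. c + Z t = x")
  case True
  then obtain t where t: "t \<in> {0..T}" "c + Z t = x" by blast
  have "s = t" if "s \<in> {0..T}" "c + Z s = x" for s
    using Z_strict_mono[of s t] Z_strict_mono[of t s] that t by (cases s t rule: linorder_cases) auto
  then have "{t \<in> {0..T}. c + Z t = x} \<subseteq> {t}" by blast
  then show ?thesis using negligible_subset negligible_sing by blast
next
  case False
  then have "{t \<in> {0..T}. c + Z t = x} = {}" by blast
  then show ?thesis by (simp only: negligible_empty)
qed

end

locale transported_test_function = test_function T \<phi> + transport_flow T Z V c0 N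
  for T \<phi> Z V c0 N
begin

text \<open>Truncating at \<open>1\<close> is harmless, because test functions vanish there.\<close>

definition Y where "Y c t = max 0 (min 1 (c + Z t))"

text \<open>The transport derivative in label coordinates, extended by \<open>0\<close> to the times
  before entrance and after exit.\<close>

definition F where "F t c = (if 0 \<le> c + Z t \<and> c + Z t < 1
  then partial_t T \<phi> t (c + Z t) + V t * partial_x \<phi> t (c + Z t) else 0)"

lemma Y_range: "Y c t \<in> {0..1}" by (auto simp: Y_def)

lemma Y_lipschitz: "s \<in> {0..T} \<Longrightarrow> t \<in> {0..T} \<Longrightarrow> \<bar>Y c s - Y c t\<bar> \<le> \<bar>s - t\<bar>"
  using Z_lipschitz[of s t] by (auto simp: Y_def)

text \<open>Inside the unit interval the derivative of \<open>h\<close> exists by Stepanov's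
  theorem, and the chain rule identifies it with \<open>F\<close>; after exit both vanish. Times
  before entrance are left out, because there \<open>h\<close> is \<open>\<phi> s 0\<close> and may
  vary while \<open>F\<close> is \<open>0\<close>.\<close>

lemma trajectory_derivative:
  "\<exists>M. negligible M \<and> (\<forall>t\<in>{0..T} - M. 0 \<le> c + Z t \<longrightarrow>
    (c + Z t < 1 \<longrightarrow> (\<lambda>s. \<phi> s (c + Z t)) differentiable (at t within {0..T})) \<and>
    ((\<lambda>s. \<phi> s (Y c s)) has_real_derivative F t c) (at t within {0..T}))"
proof -
  define h where "h = (\<lambda>s. \<phi> s (Y c s))"
  \<comment> \<open>The crossing times of \<open>0\<close> and \<open>1\<close> are removed because
    truncation puts a kink into \<open>Y c\<close> there.\<close>
  define M where "M = N \<union> {t \<in> {0..T}. \<not> h differentiable (at t within {0..T})} \<union>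
    {t \<in> {0..T}. c + Z t = 0} \<union> {t \<in> {0..T}. c + Z t = 1}"
  obtain K where K: "\<forall>t\<in>{0..T}. \<forall>v\<in>{0..T}. \<bar>h v - h t\<bar> \<le> K t * \<bar>v - t\<bar>"
    unfolding h_def using pointwise_lipschitz_along_curve[of "Y c"] Y_range Y_lipschitz by blast
  have "negligible {t \<in> {0..T}. \<not> h differentiable (at t within {0..T})}"
    by (rule negligible_nondifferentiable_pointwise_lipschitz) (use K in blast)
  then have "negligible M"
    unfolding M_def by (intro negligible_Un N negligible_level)
  have inner: "((\<lambda>s. \<phi> s (c + Z t)) has_real_derivative F t c - V t * partial_x \<phi> t (c + Z t)) (at t within {0..T})
      \<and> (h has_real_derivative F t c) (at t within {0..T})"
    if t: "t \<in> {0..T}" "t \<notin> M" "0 \<le> c + Z t" "c + Z t < 1" for t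
  proof -
    have pos: "0 < c + Z t" using t by (force simp: M_def)
    then have Yt: "Y c t = c + Z t" using t by (simp add: Y_def)
    have "((\<lambda>s. c + Z s) has_real_derivative V t) (at t within {0..T})"
      using Z_deriv[of t] t by (auto simp: M_def intro!: derivative_eq_intros)
    then have "(Y c has_real_derivative V t) (at t within {0..T})"
    proof (rule has_field_derivative_transform_within)
      \<comment> \<open>\<open>Z\<close> moves with speed at most \<open>1\<close>, so the particle
        cannot reach the boundary within this time.\<close>
      show "0 < min (c + Z t) (1 - (c + Z t))" using pos t by simp
      fix s assume "s \<in> {0..T}" "dist s t < min (c + Z t) (1 - (c + Z t))"
      then show "c + Z s = Y c s" using Z_lipschitz[of s t] t by (auto simp: Y_def dist_real_def)
    qed (use t in auto)
    then have 1: "((\<lambda>s. \<phi> s (Y c s) - \<phi> s (Y c t)) has_real_derivative V t * partial_x \<phi> t (Y c t)) (at t within {0..T})"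
      using Y_range t by (intro derivative_along_curve) auto
    obtain D where D: "(h has_real_derivative D) (at t within {0..T})"
      using t by (auto simp: M_def real_differentiable_def)
    from DERIV_diff[OF D 1] have 2: "((\<lambda>s. \<phi> s (c + Z t)) has_real_derivative D - V t * partial_x \<phi> t (c + Z t)) (at t within {0..T})"
      by (simp add: h_def Yt)
    then have "partial_t T \<phi> t (c + Z t) = D - V t * partial_x \<phi> t (c + Z t)"
      using t by (intro partial_t_eqI)
    then have "D = F t c" using t by (simp add: F_def)
    then show ?thesis using D 2 by simp
  qed
  have outer: "(h has_real_derivative F t c) (at t within {0..T})" if t: "t \<in> {0..T}" "1 < c + Z t" for t
  proof -
    have "((\<lambda>_. 0) has_real_derivative 0) (at t within {0..T})" by simp
    then have "(h has_real_derivative 0) (at t within {0..T})"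
    proof (rule has_field_derivative_transform_within)
      show "0 < c + Z t - 1" using t by simp
      fix s assume "s \<in> {0..T}" "dist s t < c + Z t - 1"
      then show "0 = h s" using Z_lipschitz[of s t] t by (auto simp: h_def Y_def dist_real_def zero_right)
    qed (use t in auto)
    then show ?thesis using t by (simp add: F_def)
  qed
  show ?thesis
  proof (intro exI[of _ M] conjI ballI impI)
    fix t assume t: "t \<in> {0..T} - M" "0 \<le> c + Z t"
    then have t': "t \<in> {0..T}" "t \<notin> M" by auto
    have "c + Z t < 1 \<or> 1 < c + Z t" using t by (auto simp: M_def)
    then show "((\<lambda>s. \<phi> s (Y c s)) has_real_derivative F t c) (at t within {0..T})"
      using inner[OF t' t(2)] outer[OF t'(1)] unfolding h_def by blast
    assume "c + Z t < 1"
    from inner[OF t' t(2) this] show "(\<lambda>s. \<phi> s (c + Z t)) differentiable (at t within {0..T})"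
      by (auto simp: real_differentiable_def)
  qed (fact \<open>negligible M\<close>)
qed

lemma trajectory_integral:
  assumes s: "0 \<le> s" "s \<le> \<tau>" "\<tau> \<le> T" and c: "0 \<le> c + Z s"
  shows "((\<lambda>t. F t c) has_integral (\<phi> \<tau> (Y c \<tau>) - \<phi> s (Y c s))) {s..\<tau>}"
proof -
  obtain M where M: "negligible M" "\<forall>t\<in>{0..T} - M. 0 \<le> c + Z t \<longrightarrow>
      (c + Z t < 1 \<longrightarrow> (\<lambda>s. \<phi> s (c + Z t)) differentiable (at t within {0..T})) \<and>
      ((\<lambda>s. \<phi> s (Y c s)) has_real_derivative F t c) (at t within {0..T})"
    using trajectory_derivative[of c] by blast
  obtain K where K: "\<forall>t\<in>{0..T}. \<forall>v\<in>{0..T}. \<bar>\<phi> v (Y c v) - \<phi> t (Y c t)\<bar> \<le> K t * \<bar>v - t\<bar>"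
    using pointwise_lipschitz_along_curve[of "Y c"] Y_range Y_lipschitz by blast
  show ?thesis
  proof (rule has_integral_derivative_pointwise_lipschitz[OF s(2) M(1), where K = K])
    fix t assume t: "t \<in> {s..\<tau>}" "t \<notin> M"
    then have "0 \<le> c + Z t" "t \<in> {0..T} - M" using Z_mono[of s t] s c by auto
    then have "((\<lambda>s. \<phi> s (Y c s)) has_real_derivative F t c) (at t within {0..T})"
      using M(2) by blast
    then show "((\<lambda>s. \<phi> s (Y c s)) has_real_derivative F t c) (at t within {s..\<tau>})"
      by (rule has_field_derivative_subset) (use s in auto)
  qed (use s K in auto)
qed

end

section \<open>Joint measurability of the time derivative\<close>

context test_function
begin

text \<open>The derivative can only be the limit \<open>d\<close> of the left difference quotients,
  and continuity in time reduces the test for it to rational times. Time \<open>0\<close> is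
  excluded to leave room on the left.\<close>

lemma differentiability_set_measurable:
  obtains D :: "(real \<times> real) set" and g :: "real \<times> real \<Rightarrow> real" where "D \<in> sets borel" "g \<in> borel_measurable borel"
    "\<And>t x. t \<in> {0<..T} \<Longrightarrow> x \<in> {0..1} \<Longrightarrow> (t, x) \<in> D \<longleftrightarrow> (\<lambda>s. \<phi> s x) differentiable (at t within {0..T})"
    "\<And>t x. t \<in> {0<..T} \<Longrightarrow> x \<in> {0..1} \<Longrightarrow> partial_t T \<phi> t x = g (t, x)"
proof -
  \<comment> \<open>Clamping both arguments extends \<open>\<phi>\<close> continuously to the
    plane.\<close>
  define \<Phi> where "\<Phi> = (\<lambda>s x. \<phi> (max 0 (min T s)) (max 0 (min 1 x)))"
  have \<Phi>_eq: "\<Phi> s x = \<phi> s x" if "s \<in> {0..T}" "x \<in> {0..1}" for s x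
    using that by (simp add: \<Phi>_def)
  have "continuous_on UNIV (\<lambda>(s, x). \<Phi> s x)"
    unfolding \<Phi>_def split_def
    by (rule continuous_on_compose2[OF continuous, where f = "\<lambda>z. (max 0 (min T (fst z)), max 0 (min 1 (snd z)))", simplified split_def, simplified])
      (use T_pos in \<open>auto intro!: continuous_intros\<close>)
  then have \<Phi>_meas: "(\<lambda>z. \<Phi> (a z) (b z)) \<in> borel_measurable borel"
    if "continuous_on UNIV a" "continuous_on UNIV b" for a b :: "real \<times> real \<Rightarrow> real"
    using that by (intro borel_measurable_continuous_onI)
      (auto intro!: continuous_on_compose2[of UNIV "\<lambda>(s, x). \<Phi> s x" UNIV "\<lambda>z. (a z, b z)", simplified] continuous_intros)
  have fst_meas [measurable]: "fst \<in> borel_measurable (borel :: (real \<times> real) measure)"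
    by (intro borel_measurable_continuous_onI continuous_intros)
  define q where "q = (\<lambda>n z. (\<Phi> (fst z) (snd z) - \<Phi> (fst z - 1 / Suc n) (snd z)) * Suc n)"
  have q_meas [measurable]: "q n \<in> borel_measurable borel" for n
    unfolding q_def by (intro borel_measurable_times borel_measurable_diff \<Phi>_meas continuous_intros) auto
  \<comment> \<open>Where the quotients diverge, \<open>lim\<close> returns some arbitrary value.
    This is harmless, as membership in \<open>D\<close> forces \<open>d\<close> to be the derivative
    at the points considered.\<close>
  define d where "d = (\<lambda>z. lim (\<lambda>n. q n z))"
  have d_meas [measurable]: "d \<in> borel_measurable borel"
    unfolding d_def by (intro borel_measurable_lim_metric q_meas)
  define A where "A = (\<lambda>n m r. {z. r \<in> {0..T} \<and> \<bar>r - fst z\<bar> < 1 / Suc m \<longrightarrow>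
    \<bar>\<Phi> r (snd z) - \<Phi> (fst z) (snd z) - d z * (r - fst z)\<bar> \<le> \<bar>r - fst z\<bar> / Suc n})"
  define D where "D = (\<Inter>n. \<Union>m. \<Inter>r\<in>\<rat>. A n m r)"
  have A_meas: "A n m r \<in> sets borel" for n m r
  proof -
    have [measurable]: "(\<lambda>z :: real \<times> real. \<Phi> r (snd z)) \<in> borel_measurable borel"
      "(\<lambda>z :: real \<times> real. \<Phi> (fst z) (snd z)) \<in> borel_measurable borel"
      using \<Phi>_meas[of "\<lambda>_. r" snd] \<Phi>_meas[of fst snd] by (simp_all add: continuous_on_fst continuous_on_snd)
    have "{z \<in> space borel. r \<in> {0..T} \<and> \<bar>r - fst z\<bar> < 1 / Suc m \<longrightarrow>
      \<bar>\<Phi> r (snd z) - \<Phi> (fst z) (snd z) - d z * (r - fst z)\<bar> \<le> \<bar>r - fst z\<bar> / Suc n} \<in> sets borel"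
      by measurable
    then show ?thesis by (simp add: A_def)
  qed
  have D_meas: "D \<in> sets borel"
    unfolding D_def
    by (intro sets.countable_INT'' sets.countable_UN'' countable_rat A_meas) auto
  have fwd: "d (t, x) = D' \<and> (t, x) \<in> D"
    if t: "t \<in> {0<..T}" and x: "x \<in> {0..1}" and der: "((\<lambda>s. \<phi> s x) has_real_derivative D') (at t within {0..T})" for t x D'
  proof -
    have "(\<lambda>n. t - 1 / Suc n) \<longlonglongrightarrow> t - 0"
      by (intro tendsto_intros LIMSEQ_inverse_real_of_nat[unfolded inverse_eq_divide])
    then have lim: "(\<lambda>n. t - 1 / Suc n) \<longlonglongrightarrow> t" by simp
    have ev: "\<forall>\<^sub>F n in sequentially. t - 1 / Suc n \<in> {0..T} \<and> t - 1 / Suc n \<noteq> t"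
      using order_tendstoD(1)[OF lim, of 0] t by (auto elim!: eventually_mono intro: order_trans[of _ t])
    then have "filterlim (\<lambda>n. t - 1 / Suc n) (at t within {0..T}) sequentially"
      using lim by (auto simp: filterlim_at elim: eventually_mono)
    then have "(\<lambda>n. (\<phi> (t - 1 / Suc n) x - \<phi> t x) / (t - 1 / Suc n - t)) \<longlonglongrightarrow> D'"
      using der[unfolded has_field_derivative_iff] by (rule filterlim_compose[rotated])
    moreover have "\<forall>\<^sub>F n in sequentially. (\<phi> (t - 1 / Suc n) x - \<phi> t x) / (t - 1 / Suc n - t) = q n (t, x)"
      using ev
    proof eventually_elim
      case (elim n)
      then show ?case using t x by (simp add: q_def \<Phi>_eq field_simps)
    qed
    ultimately have "(\<lambda>n. q n (t, x)) \<longlonglongrightarrow> D'" by (rule Lim_transform_eventually)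
    then have d: "d (t, x) = D'" unfolding d_def by (rule limI)
    have "(t, x) \<in> D" unfolding D_def
    proof (intro INT_I)
      fix n
      obtain \<delta> where \<delta>: "0 < \<delta>" "\<forall>y\<in>{0..T}. norm (y - t) < \<delta> \<longrightarrow>
          norm (\<phi> y x - \<phi> t x - D' * (y - t)) \<le> 1 / Suc n * norm (y - t)"
        using der[unfolded has_field_derivative_def has_derivative_within_alt, THEN conjunct2, rule_format, of "1 / Suc n"]
        by auto
      obtain m where m: "1 / Suc m < \<delta>" using \<delta>(1) nat_approx_posE by blast
      have "(t, x) \<in> (\<Inter>r\<in>\<rat>. A n m r)"
        using \<delta>(2) m t x by (auto simp: A_def d \<Phi>_eq)
      then show "(t, x) \<in> (\<Union>m. \<Inter>r\<in>\<rat>. A n m r)" by blast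
    qed
    with d show ?thesis by blast
  qed
  have bwd: "((\<lambda>s. \<phi> s x) has_real_derivative d (t, x)) (at t within {0..T})"
    if t: "t \<in> {0<..T}" and x: "x \<in> {0..1}" and tx: "(t, x) \<in> D" for t x
    unfolding has_field_derivative_def has_derivative_within_alt
  proof (intro conjI allI impI)
    fix e :: real assume "0 < e"
    then obtain n where n: "1 / Suc n < e" using nat_approx_posE by blast
    have "(t, x) \<in> (\<Union>m. \<Inter>r\<in>\<rat>. A n m r)" using tx unfolding D_def by (rule INT_D) simp
    then obtain m where m: "(t, x) \<in> (\<Inter>r\<in>\<rat>. A n m r)" by (rule UN_E)
    \<comment> \<open>The violation of the derivative estimate. It is continuous, so a violation at
      \<open>y\<close> would persist at nearby rational times.\<close>
    define G where "G = (\<lambda>y. \<bar>\<phi> y x - \<phi> t x - d (t, x) * (y - t)\<bar> - \<bar>y - t\<bar> / Suc n)"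
    have rat: "G r \<le> 0" if "r \<in> \<rat>" "r \<in> {0..T}" "\<bar>r - t\<bar> < 1 / Suc m" for r
      using INT_D[OF m that(1)] that t x by (auto simp: A_def G_def \<Phi>_eq)
    obtain L where "L-lipschitz_on {0..T} (\<lambda>t. \<phi> t x)" using lipschitz_t[OF x] by blast
    then have "continuous_on {0..T} (\<lambda>t. \<phi> t x)" by (rule lipschitz_on_continuous_on)
    then have G_cont: "continuous_on {0..T} G" unfolding G_def by (intro continuous_intros) auto
    have "G y \<le> 0" if y: "y \<in> {0..T}" "\<bar>y - t\<bar> < 1 / Suc m" for y
    proof (rule ccontr)
      assume "\<not> G y \<le> 0"
      then have "0 < G y" by simp
      then obtain \<eta> where \<eta>: "0 < \<eta>" "\<forall>r\<in>{0..T}. dist r y < \<eta> \<longrightarrow> dist (G r) (G y) < G y"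
        using G_cont[unfolded continuous_on_iff, THEN bspec, OF y(1), THEN spec, THEN mp, OF \<open>0 < G y\<close>] by blast
      have "y \<noteq> t" using \<open>0 < G y\<close> by (auto simp: G_def)
      \<comment> \<open>The rational time is chosen between \<open>t\<close> and \<open>y\<close>,
        which keeps it in \<open>{0..T}\<close> and within \<open>1 / Suc m\<close> of
        \<open>t\<close>.\<close>
      then consider "t < y" | "y < t" by linarith
      then obtain r where "r \<in> \<rat>" "r \<in> {0..T}" "\<bar>r - t\<bar> < 1 / Suc m" "dist r y < \<eta>"
      proof cases
        case 1
        obtain r where "r \<in> \<rat>" "max t (y - \<eta>) < r" "r < y"
          using Rats_dense_in_real[of "max t (y - \<eta>)" y] 1 \<eta>(1) by auto
        then show thesis using that[of r] y t by (auto simp: dist_real_def)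
      next
        case 2
        obtain r where "r \<in> \<rat>" "y < r" "r < min t (y + \<eta>)"
          using Rats_dense_in_real[of y "min t (y + \<eta>)"] 2 \<eta>(1) by auto
        then show thesis using that[of r] y t by (auto simp: dist_real_def)
      qed
      then have "G r \<le> 0" "dist (G r) (G y) < G y" using rat \<eta>(2) by blast+
      then show False by (simp add: dist_real_def)
    qed
    then have "\<bar>\<phi> y x - \<phi> t x - d (t, x) * (y - t)\<bar> \<le> e * \<bar>y - t\<bar>" if "y \<in> {0..T}" "\<bar>y - t\<bar> < 1 / Suc m" for y
      using that mult_right_mono[OF less_imp_le[OF n], of "\<bar>y - t\<bar>"] by (force simp: G_def)
    then show "\<exists>\<delta>>0. \<forall>y\<in>{0..T}. norm (y - t) < \<delta> \<longrightarrow> norm (\<phi> y x - \<phi> t x - d (t, x) * (y - t)) \<le> e * norm (y - t)"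
      by (intro exI[of _ "1 / Suc m"]) auto
  qed (rule bounded_linear_mult_right)
  \<comment> \<open>Off \<open>D\<close> no derivative exists, so \<open>vector_derivative\<close>
    is a choice from the empty predicate. This is one fixed number, and \<open>g\<close> stays
    measurable.\<close>
  define g where "g = (\<lambda>z. if z \<in> D then d z else (SOME f' :: real. False))"
  show thesis
  proof (rule that[of D g])
    show "g \<in> borel_measurable borel" using D_meas unfolding g_def by measurable
    fix t x assume t: "t \<in> {0<..T}" and x: "x \<in> {0..1::real}"
    show iff: "(t, x) \<in> D \<longleftrightarrow> (\<lambda>s. \<phi> s x) differentiable (at t within {0..T})"
      using fwd[OF t x] bwd[OF t x] by (auto simp: real_differentiable_def)
    show "partial_t T \<phi> t x = g (t, x)"
    proof (cases "(t, x) \<in> D")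
      case True
      then show ?thesis using partial_t_eqI[OF bwd[OF t x True]] t by (simp add: g_def)
    next
      case False
      then have "\<And>f'. \<not> ((\<lambda>s. \<phi> s x) has_vector_derivative f') (at t within {0..T})"
        using iff differentiableI_vector by blast
      then show ?thesis using False by (simp add: partial_t_def vector_derivative_def g_def)
    qed
  qed (fact D_meas)
qed

end

section \<open>Transported measures\<close>

locale transported_measure = transported_test_function T \<phi> Z V c0 N
  for T \<phi> Z V c0 N +
  fixes \<nu> :: "real measure" and \<rho> :: "real \<Rightarrow> real measure" and \<alpha> :: "real \<Rightarrow> real"
  assumes \<nu>_sets: "sets \<nu> = sets borel" and \<nu>_finite: "finite_measure \<nu>"
    and Z_meas: "Z \<in> borel_measurable borel" and V_meas: "V \<in> borel_measurable (lebesgue_on {0..T})"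
    and V_bound: "\<And>t. t \<in> {0..T} \<Longrightarrow> \<bar>V t\<bar> \<le> 1"
    and V_eq: "\<And>t. V t = \<alpha> (total_mass \<rho> t)"
    and push: "\<And>t. t \<in> {0..T} \<Longrightarrow> \<rho> t = distr (restrict_space \<nu> {c. 0 \<le> c + Z t \<and> c + Z t < 1})
      (restrict_space borel {0..<1}) (\<lambda>c. c + Z t)"
begin

declare \<nu>_sets [measurable_cong, simp] Z_meas [measurable]

lemma space_\<nu> [simp]: "space \<nu> = UNIV"
  using sets_eq_imp_space_eq[OF \<nu>_sets] by simp

definition A where "A t = {c. 0 \<le> c + Z t \<and> c + Z t < 1}"

lemma A_meas [measurable]: "A t \<in> sets borel" unfolding A_def by measurable

definition f where "f = transport_derivative \<alpha> T \<rho> \<phi>"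

lemma f_eq: "f t x = partial_t T \<phi> t x + V t * partial_x \<phi> t x"
  by (simp add: f_def transport_derivative_def V_eq)

lemma F_eq: "F t c = indicator (A t) c *\<^sub>R f t (c + Z t)"
  by (simp add: F_def f_eq A_def indicator_def)

lemma shift_meas [measurable]: "(\<lambda>c. c + Z t) \<in> measurable (restrict_space \<nu> (A t)) (restrict_space borel {0..<1})"
  by (intro measurable_restrict_space2 measurable_restrict_space1) (auto simp: space_restrict_space A_def)

lemma
  assumes t: "t \<in> {0..T}" and g: "(g :: real \<Rightarrow> real) \<in> borel_measurable (restrict_space borel {0..<1})"
  shows integrable_\<rho>_iff: "integrable (\<rho> t) g \<longleftrightarrow> integrable \<nu> (\<lambda>c. indicator (A t) c *\<^sub>R g (c + Z t))"
    and integral_\<rho>: "(LINT x|\<rho> t. g x) = (LINT c|\<nu>. indicator (A t) c *\<^sub>R g (c + Z t))"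
  unfolding push[OF t, folded A_def]
  by (subst integrable_distr_eq[OF shift_meas g], subst integrable_restrict_space, simp_all)
    (subst integral_distr[OF shift_meas g], subst integral_restrict_space, simp_all)

text \<open>Almost everywhere statements pass through an image measure for measurable sets, so
  \<open>P\<close> is represented by a Borel set that agrees with it on
  \<open>{0..<1}\<close>.\<close>

lemma AE_\<rho>:
  assumes t: "t \<in> {0..T}" and D: "D \<in> sets borel" "\<And>x. x \<in> {0..<1} \<Longrightarrow> x \<in> D \<longleftrightarrow> P x"
    and AE: "AE c in \<nu>. c \<in> A t \<longrightarrow> c + Z t \<in> D"
  shows "AE x in \<rho> t. P x"
proof -
  have "{x \<in> space (restrict_space borel {0..<1}). x \<in> D} = D \<inter> {0..<1}" by (auto simp: space_restrict_space)
  moreover have "D \<inter> {0..<1} \<in> sets (restrict_space borel {0..<1})"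
    using D by (auto simp: sets_restrict_space)
  ultimately have "(AE x in \<rho> t. x \<in> D) \<longleftrightarrow> (AE c in restrict_space \<nu> (A t). c + Z t \<in> D)"
    unfolding push[OF t, folded A_def] by (intro AE_distr_iff shift_meas) simp
  then have "AE x in \<rho> t. x \<in> D"
    using AE by (simp add: AE_restrict_space_iff)
  moreover have "AE x in \<rho> t. x \<in> space (\<rho> t)" by (rule AE_space)
  moreover have "space (\<rho> t) = {0..<1}" by (simp add: push[OF t] space_restrict_space)
  ultimately show ?thesis using D(2) by (auto elim: eventually_elim2)
qed

lemma id_meas: "(\<lambda>t. t) \<in> borel_measurable (lebesgue_on S)"
  by (intro measurable_restrict_space1 measurable_completion) auto

definition G where "G t x = partial_x \<phi> (max 0 (min T t)) (max 0 (min 1 x))"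

lemma G_meas: "(\<lambda>(t, x). G t x) \<in> borel_measurable borel"
proof (rule borel_measurable_continuous_onI)
  show "continuous_on UNIV (\<lambda>(t, x). G t x)"
    unfolding G_def split_def
    by (rule continuous_on_compose2[OF continuous_partial_x, where f = "\<lambda>z. (max 0 (min T (fst z)), max 0 (min 1 (snd z)))", simplified split_def, simplified])
      (use T_pos in \<open>auto intro!: continuous_intros\<close>)
qed

lemma f_borel:
  assumes t: "t \<in> {0<..T}"
  shows "f t \<in> borel_measurable (restrict_space borel {0..<1})"
proof -
  obtain D g where g: "g \<in> borel_measurable borel"
    "\<And>t x. t \<in> {0<..T} \<Longrightarrow> x \<in> {0..1} \<Longrightarrow> partial_t T \<phi> t x = g (t, x)"
    using differentiability_set_measurable by metis
  have pair [measurable]: "(\<lambda>x. (t, x)) \<in> measurable borel borel"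
    by (intro borel_measurable_continuous_onI continuous_intros)
  have "(\<lambda>x. g (t, x) + V t * G t x) \<in> borel_measurable borel"
    using measurable_compose[OF pair g(1)] measurable_compose[OF pair G_meas] by simp
  then have "(\<lambda>x. g (t, x) + V t * G t x) \<in> borel_measurable (restrict_space borel {0..<1})"
    by (rule measurable_restrict_space1)
  then show ?thesis
    by (rule measurable_cong[THEN iffD1, rotated]) (use t g(2) in \<open>auto simp: space_restrict_space f_eq G_def\<close>)
qed

lemma integral_\<rho>_f:
  assumes "t \<in> {0<..T}"
  shows "(LINT x|\<rho> t. f t x) = (LINT c|\<nu>. F t c)" and "(LINT x|\<rho> t. \<bar>f t x\<bar>) = (LINT c|\<nu>. \<bar>F t c\<bar>)"
  using assms f_borel[OF assms] by (simp_all add: integral_\<rho> F_eq abs_mult)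

lemma curve_meas:
  "(\<lambda>(t, c). (t, c + Z t)) \<in> measurable (lebesgue_on S \<Otimes>\<^sub>M \<nu>) (borel :: (real \<times> real) measure)"
  unfolding borel_prod[symmetric] split_def
proof (rule measurable_Pair)
  have fst: "(\<lambda>z. fst z) \<in> borel_measurable (lebesgue_on S \<Otimes>\<^sub>M \<nu>)"
    by (rule measurable_compose[OF measurable_fst id_meas])
  then show "fst \<in> borel_measurable (lebesgue_on S \<Otimes>\<^sub>M \<nu>)" by simp
  have "snd \<in> borel_measurable (lebesgue_on S \<Otimes>\<^sub>M \<nu>)"
    using measurable_snd[of "lebesgue_on S" \<nu>] measurable_cong_sets[OF refl \<nu>_sets] by blast
  with measurable_compose[OF fst Z_meas]
  show "(\<lambda>z. snd z + Z (fst z)) \<in> borel_measurable (lebesgue_on S \<Otimes>\<^sub>M \<nu>)" by simp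
qed

text \<open>Apart from \<open>V\<close>, everything is a Borel function of the point
  \<open>(t, c + Z t)\<close>. Time carries the Lebesgue sets because \<open>V\<close> is only
  Lebesgue measurable.\<close>

lemma F_meas:
  assumes \<tau>: "\<tau> \<le> T"
  shows "(\<lambda>(t, c). F t c) \<in> borel_measurable (lebesgue_on {0<..\<tau>} \<Otimes>\<^sub>M \<nu>)"
proof -
  let ?P = "lebesgue_on {0<..\<tau>} \<Otimes>\<^sub>M \<nu>"
  obtain D g where g [measurable]: "g \<in> borel_measurable borel"
    and g_eq: "\<And>t x. t \<in> {0<..T} \<Longrightarrow> x \<in> {0..1} \<Longrightarrow> partial_t T \<phi> t x = g (t, x)"
    using differentiability_set_measurable by metis
  define p where "p = (\<lambda>(t, c). (t, c + Z t))"
  have p [measurable]: "p \<in> measurable ?P borel" unfolding p_def by (rule curve_meas)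
  define B where "B = (UNIV :: real set) \<times> {0..<1::real}"
  have B [measurable]: "B \<in> sets borel" unfolding B_def by (intro borel_Times) auto
  have "V \<in> borel_measurable (lebesgue_on {0<..\<tau>})"
    by (rule measurable_restrict_mono[OF V_meas]) (use \<tau> in auto)
  then have V [measurable]: "(\<lambda>z. V (fst z)) \<in> borel_measurable ?P"
    by (rule measurable_compose[OF measurable_fst])
  define H where "H = (\<lambda>(t, x). G t x)"
  have H [measurable]: "H \<in> borel_measurable borel" unfolding H_def by (rule G_meas)
  have "(\<lambda>z. if p z \<in> B then g (p z) + V (fst z) * H (p z) else 0) \<in> borel_measurable ?P" by measurable
  then show ?thesis
    by (rule measurable_cong[THEN iffD1, rotated])
      (use \<tau> in \<open>auto simp: space_pair_measure space_restrict_space p_def B_def H_def F_def g_eq G_def split: if_splits\<close>)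
qed

section \<open>Differentiability and integrability in label coordinates\<close>

lemma lmeasurable_Ioc: "{a<..b :: real} \<in> lmeasurable"
  by (rule bounded_set_imp_lmeasurable) (auto intro: bounded_subset[OF bounded_closed_interval[of a b]])

lemma integrable_Ioc_cong:
  fixes g h :: "real \<Rightarrow> real"
  assumes "\<And>t. t \<in> {a<..b} \<Longrightarrow> g t = h t"
  shows "integrable (lebesgue_on {a<..b}) g \<longleftrightarrow> integrable (lebesgue_on {a<..b}) h"
  by (rule Bochner_Integration.integrable_cong) (use assms in \<open>auto simp: space_restrict_space\<close>)

lemma sigma_finite_pair: "pair_sigma_finite (lebesgue_on {0<..\<tau> :: real}) \<nu>"
proof -
  have "finite_measure (lebesgue_on {0<..\<tau>})"
    by (intro finite_measure_lebesgue_on lmeasurable_Ioc)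
  then show ?thesis
    using \<nu>_finite by (simp add: pair_sigma_finite_def finite_measure.axioms(1))
qed

lemma AE_lebesgue_on_notin:
  assumes "negligible M" "S \<in> sets lebesgue"
  shows "AE t in lebesgue_on S. t \<in> S - M"
proof -
  have "AE t in lebesgue. t \<notin> M" using assms(1) by (intro AE_not_in) (simp add: negligible_iff_null_sets)
  then show ?thesis using assms(2) by (subst AE_restrict_space_iff) (auto elim: eventually_mono)
qed

text \<open>For every single label the bad times form a null set. Exchanging the quantifiers over
  the product turns this into a null set of bad labels at almost every time.\<close>

lemma AE_differentiable:
  assumes \<tau>: "\<tau> \<le> T"
  shows "AE t in lebesgue_on {0<..\<tau>}. (AE c in \<nu>. c \<in> A t \<longrightarrow> (\<lambda>s. \<phi> s (c + Z t)) differentiable (at t within {0..T})) \<and>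
    (AE x in \<rho> t. (\<lambda>s. \<phi> s x) differentiable (at t within {0..T}))"
proof -
  interpret pair_sigma_finite "lebesgue_on {0<..\<tau>}" \<nu> by (rule sigma_finite_pair)
  let ?P = "lebesgue_on {0<..\<tau>} \<Otimes>\<^sub>M \<nu>"
  obtain D g where D: "D \<in> sets borel"
    "\<And>t x. t \<in> {0<..T} \<Longrightarrow> x \<in> {0..1} \<Longrightarrow> (t, x) \<in> D \<longleftrightarrow> (\<lambda>s. \<phi> s x) differentiable (at t within {0..T})"
    using differentiability_set_measurable by metis
  define p where "p = (\<lambda>(t, c). (t, c + Z t))"
  have p: "p \<in> measurable ?P borel" unfolding p_def by (rule curve_meas)
  \<comment> \<open>Encodes an implication: a position in \<open>{0..<1}\<close> is a point of
    differentiability. Its measurability allows the exchange.\<close>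
  define B where "B = - ((UNIV :: real set) \<times> {0..<1::real}) \<union> D"
  have "(UNIV :: real set) \<times> {0..<1::real} \<in> sets borel" by (intro borel_Times) auto
  then have "B \<in> sets borel" unfolding B_def by (intro sets.Un borel_comp D(1))
  then have "p -` B \<inter> space ?P \<in> sets ?P" using p by (rule measurable_sets[rotated])
  moreover have "p -` B \<inter> space ?P = {z \<in> space ?P. (fst z, snd z + Z (fst z)) \<in> B}"
    by (auto simp: p_def split_def)
  ultimately have swap: "(AE t in lebesgue_on {0<..\<tau>}. AE c in \<nu>. (t, c + Z t) \<in> B)
      \<longleftrightarrow> (AE c in \<nu>. AE t in lebesgue_on {0<..\<tau>}. (t, c + Z t) \<in> B)"
    by (intro AE_commute) simp
  have "AE t in lebesgue_on {0<..\<tau>}. (t, c + Z t) \<in> B" for c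
  proof -
    obtain M where M: "negligible M" "\<forall>t\<in>{0..T} - M. 0 \<le> c + Z t \<longrightarrow>
        (c + Z t < 1 \<longrightarrow> (\<lambda>s. \<phi> s (c + Z t)) differentiable (at t within {0..T})) \<and>
        ((\<lambda>s. \<phi> s (Y c s)) has_real_derivative F t c) (at t within {0..T})"
      using trajectory_derivative[of c] by blast
    have "AE t in lebesgue_on {0<..\<tau>}. t \<in> {0<..\<tau>} - M"
      by (rule AE_lebesgue_on_notin[OF M(1)]) auto
    then show ?thesis
    proof eventually_elim
      case (elim t)
      then have "t \<in> {0..T} - M" "t \<in> {0<..T}" using \<tau> by auto
      then show ?case using M(2) D(2)[of t "c + Z t"] by (auto simp: B_def)
    qed
  qed
  then have "AE t in lebesgue_on {0<..\<tau>}. AE c in \<nu>. (t, c + Z t) \<in> B" unfolding swap by simp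
  moreover have "AE t in lebesgue_on {0<..\<tau>}. t \<in> {0<..\<tau>} - {}" by (rule AE_lebesgue_on_notin) auto
  ultimately show ?thesis
  proof eventually_elim
    case (elim t)
    have t: "t \<in> {0<..T}" "t \<in> {0..T}" using elim \<tau> by auto
    have D_iff: "(t, x) \<in> D \<longleftrightarrow> (\<lambda>s. \<phi> s x) differentiable (at t within {0..T})" if "x \<in> {0..<1}" for x
      using D(2)[OF t(1), of x] that by auto
    have AE_D: "AE c in \<nu>. c \<in> A t \<longrightarrow> (t, c + Z t) \<in> D"
      using elim(1) by eventually_elim (auto simp: B_def A_def)
    then have "AE c in \<nu>. c \<in> A t \<longrightarrow> (\<lambda>s. \<phi> s (c + Z t)) differentiable (at t within {0..T})"
      by eventually_elim (auto simp: A_def D_iff)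
    moreover have "AE x in \<rho> t. (\<lambda>s. \<phi> s x) differentiable (at t within {0..T})"
    proof (rule AE_\<rho>[OF t(2)])
      have "(\<lambda>x. (t, x)) \<in> measurable borel borel"
        by (intro borel_measurable_continuous_onI continuous_intros)
      from measurable_sets[OF this D(1)] show "{x. (t, x) \<in> D} \<in> sets borel" by (simp add: vimage_def)
      show "x \<in> {x. (t, x) \<in> D} \<longleftrightarrow> (\<lambda>s. \<phi> s x) differentiable (at t within {0..T})" if "x \<in> {0..<1}" for x
        using D_iff[OF that] by simp
      show "AE c in \<nu>. c \<in> A t \<longrightarrow> c + Z t \<in> {x. (t, x) \<in> D}" using AE_D by simp
    qed
    ultimately show ?case by blast
  qed
qed

lemma AE_lebesgue_on_Ioc: "AE t in lebesgue_on {0<..\<tau> :: real}. t \<in> {0<..\<tau>}"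
proof -
  have "AE t in lebesgue_on {0<..\<tau>}. t \<in> {0<..\<tau>} - {}" by (rule AE_lebesgue_on_notin) auto
  then show ?thesis by (simp only: Diff_empty)
qed

lemma double_integrable_if_uniformly_lipschitz:
  assumes \<tau>: "\<tau> \<le> T" and L: "\<forall>x\<in>{0..<1}. L-lipschitz_on {0..T} (\<lambda>t. \<phi> t x)"
  shows "double_integrable \<tau> \<rho> f"
proof -
  interpret pair_sigma_finite "lebesgue_on {0<..\<tau>}" \<nu> by (rule sigma_finite_pair)
  interpret N: finite_measure \<nu> by (rule \<nu>_finite)
  interpret M: finite_measure "lebesgue_on {0<..\<tau>}"
    by (intro finite_measure_lebesgue_on lmeasurable_Ioc)
  \<comment> \<open>\<open>L\<close> bounds the time derivative, and \<open>C\<close> bounds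
    \<open>V t * partial_x\<close> because the speed is at most \<open>1\<close>.\<close>
  define B where "B = L + C"
  have "0 \<le> L" using L lipschitz_on_nonneg[of L "{0..T}" "\<lambda>t. \<phi> t 0"] by auto
  then have "0 \<le> B" using C(1) by (simp add: B_def)
  have F1: "(\<lambda>c. F t c) \<in> borel_measurable \<nu>" if "t \<in> {0<..\<tau>}" for t
    using measurable_Pair2[OF F_meas[OF \<tau>], of t] that by (simp add: space_restrict_space)
  have bound: "AE t in lebesgue_on {0<..\<tau>}. AE c in \<nu>. \<bar>F t c\<bar> \<le> B"
    using AE_differentiable[OF \<tau>] AE_lebesgue_on_Ioc
  proof eventually_elim
    case (elim t)
    then have t: "t \<in> {0..T}" using \<tau> by auto
    have "AE c in \<nu>. c \<in> A t \<longrightarrow> (\<lambda>s. \<phi> s (c + Z t)) differentiable (at t within {0..T})"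
      using elim(1) by blast
    then show ?case
    proof eventually_elim
      case (elim c)
      show ?case
      proof (cases "c \<in> A t")
        case True
        then have x: "c + Z t \<in> {0..<1}" by (simp add: A_def)
        have "\<bar>partial_t T \<phi> t (c + Z t)\<bar> \<le> L" using elim True x L t by (intro partial_t_bound) auto
        moreover have "\<bar>V t * partial_x \<phi> t (c + Z t)\<bar> \<le> 1 * C"
          unfolding abs_mult using V_bound[OF t] C(2)[OF t, of "c + Z t"] x by (intro mult_mono) auto
        ultimately show ?thesis using True by (simp add: F_eq f_eq B_def)
      qed (simp add: F_eq \<open>0 \<le> B\<close>)
    qed
  qed
  have int_eq: "(LINT x|\<rho> t. f t x) = (LINT c|\<nu>. F t c)" "(LINT x|\<rho> t. \<bar>f t x\<bar>) = (LINT c|\<nu>. \<bar>F t c\<bar>)"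
    if "t \<in> {0<..\<tau>}" for t
    using that \<tau> by (auto intro!: integral_\<rho>_f)
  have m1: "(\<lambda>t. LINT c|\<nu>. F t c) \<in> borel_measurable (lebesgue_on {0<..\<tau>})"
    by (rule M2.borel_measurable_lebesgue_integral[OF F_meas[OF \<tau>]])
  have "(\<lambda>(t, c). \<bar>F t c\<bar>) \<in> borel_measurable (lebesgue_on {0<..\<tau>} \<Otimes>\<^sub>M \<nu>)"
    using borel_measurable_abs[OF F_meas[OF \<tau>]] by (simp add: split_def)
  then have m2: "(\<lambda>t. LINT c|\<nu>. \<bar>F t c\<bar>) \<in> borel_measurable (lebesgue_on {0<..\<tau>})"
    by (rule M2.borel_measurable_lebesgue_integral)
  have intF: "AE t in lebesgue_on {0<..\<tau>}. integrable \<nu> (F t)"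
    using bound AE_lebesgue_on_Ioc
    by eventually_elim (auto intro!: N.integrable_const_bound[of _ B] F1)
  have b1: "AE t in lebesgue_on {0<..\<tau>}. norm (LINT c|\<nu>. \<bar>F t c\<bar>) \<le> B * measure \<nu> UNIV"
    using bound intF
  proof eventually_elim
    case (elim t)
    have "(LINT c|\<nu>. \<bar>F t c\<bar>) \<le> (LINT c|\<nu>. B)" using elim by (intro integral_mono_AE) auto
    then show ?case by (simp add: mult.commute)
  qed
  have b2: "AE t in lebesgue_on {0<..\<tau>}. norm (LINT c|\<nu>. F t c) \<le> B * measure \<nu> UNIV"
    using b1
  proof eventually_elim
    case (elim t)
    have "\<bar>LINT c|\<nu>. F t c\<bar> \<le> (LINT c|\<nu>. \<bar>F t c\<bar>)" by (rule integral_abs_bound)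
    also have "\<dots> \<le> B * measure \<nu> UNIV" using elim by (simp add: abs_le_iff)
    finally show ?case by simp
  qed
  have "integrable (lebesgue_on {0<..\<tau>}) (\<lambda>t. LINT c|\<nu>. F t c)"
    "integrable (lebesgue_on {0<..\<tau>}) (\<lambda>t. LINT c|\<nu>. \<bar>F t c\<bar>)"
    by (rule M.integrable_const_bound[OF b2 m1], rule M.integrable_const_bound[OF b1 m2])
  then have "integrable (lebesgue_on {0<..\<tau>}) (\<lambda>t. LINT x|\<rho> t. f t x)"
    "integrable (lebesgue_on {0<..\<tau>}) (\<lambda>t. LINT x|\<rho> t. \<bar>f t x\<bar>)"
    by (simp_all only: integrable_Ioc_cong[OF int_eq(1)] integrable_Ioc_cong[OF int_eq(2)])
  moreover have "AE t in lebesgue_on {0<..\<tau>}. integrable (\<rho> t) (f t)"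
    using intF AE_lebesgue_on_Ioc
    by eventually_elim (use \<tau> in \<open>auto simp: integrable_\<rho>_iff f_borel F_eq[abs_def]\<close>)
  ultimately show ?thesis unfolding double_integrable_def by blast
qed

text \<open>The absolute-value clause of \<open>double_integrable\<close> is what Tonelli's
  criterion asks for to pass from iterated integrals to the product.\<close>

lemma integrable_F_if_double_integrable:
  assumes \<tau>: "\<tau> \<le> T" and di: "double_integrable \<tau> \<rho> f"
  shows "integrable (lebesgue_on {0<..\<tau>} \<Otimes>\<^sub>M \<nu>) (\<lambda>(t, c). F t c)"
proof -
  interpret pair_sigma_finite "lebesgue_on {0<..\<tau>}" \<nu> by (rule sigma_finite_pair)
  have abs_eq: "(LINT x|\<rho> t. \<bar>f t x\<bar>) = (LINT c|\<nu>. \<bar>F t c\<bar>)" if "t \<in> {0<..\<tau>}" for t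
    using that \<tau> by (auto intro!: integral_\<rho>_f)
  show ?thesis
  proof (rule Fubini_integrable[OF F_meas[OF \<tau>]])
    have "integrable (lebesgue_on {0<..\<tau>}) (\<lambda>t. LINT x|\<rho> t. \<bar>f t x\<bar>)"
      using di unfolding double_integrable_def by blast
    then have "integrable (lebesgue_on {0<..\<tau>}) (\<lambda>t. LINT c|\<nu>. \<bar>F t c\<bar>)"
      by (rule integrable_Ioc_cong[OF abs_eq, THEN iffD1, rotated])
    then show "integrable (lebesgue_on {0<..\<tau>}) (\<lambda>t. LINT c|\<nu>. norm (case (t, c) of (t, c) \<Rightarrow> F t c))" by simp
    have "AE t in lebesgue_on {0<..\<tau>}. integrable (\<rho> t) (f t)"
      using di unfolding double_integrable_def by blast
    then show "AE t in lebesgue_on {0<..\<tau>}. integrable \<nu> (\<lambda>c. case (t, c) of (t, c) \<Rightarrow> F t c)"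
      using AE_lebesgue_on_Ioc
      by eventually_elim (use \<tau> in \<open>auto simp: integrable_\<rho>_iff f_borel F_eq[abs_def]\<close>)
  qed
qed

text \<open>Here \<open>s\<close> is the entrance time. Before it the position is negative and
  \<open>F\<close> vanishes; after it the gauge integral is known and equals the Lebesgue integral
  by the assumed integrability.\<close>

lemma trajectory_lebesgue_integral:
  assumes s: "0 \<le> s" "s \<le> T" "\<tau> \<in> {0..T}" and c: "0 \<le> c + Z s" "s = 0 \<or> c + Z s = 0"
    and int: "integrable (lebesgue_on {0<..\<tau>}) (\<lambda>t. F t c)"
  shows "(LINT t|lebesgue_on {0<..\<tau>}. F t c) = (if s \<le> \<tau> then \<phi> \<tau> (Y c \<tau>) - \<phi> s (Y c s) else 0)"
proof -
  have 0: "F t c = 0" if "t \<in> {0..T}" "t < s" for t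
    using Z_strict_mono[of t s] that s c by (auto simp: F_def)
  have "(LINT t|lebesgue_on {0<..\<tau>}. F t c) = integral {0<..\<tau>} (\<lambda>t. F t c)"
    using int by (intro lebesgue_integral_eq_integral) auto
  also have "\<dots> = integral {0..\<tau>} (\<lambda>t. F t c)"
    by (rule integral_spike_set) (auto intro: negligible_subset[of "{0}"])
  also have "\<dots> = (if s \<le> \<tau> then \<phi> \<tau> (Y c \<tau>) - \<phi> s (Y c s) else 0)"
  proof (cases "s \<le> \<tau>")
    case True
    have "((\<lambda>t. F t c) has_integral (\<phi> \<tau> (Y c \<tau>) - \<phi> s (Y c s))) {0..\<tau>}"
    proof (rule has_integral_eq)
      have sub: "{s..\<tau>} \<subseteq> {0..\<tau>}" using s by auto
      show "((\<lambda>t. if t \<in> {s..\<tau>} then F t c else 0) has_integral (\<phi> \<tau> (Y c \<tau>) - \<phi> s (Y c s))) {0..\<tau>}"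
        unfolding has_integral_restrict[OF sub] by (rule trajectory_integral) (use s c True in auto)
    qed (use s 0 in auto)
    then show ?thesis using True by (simp add: integral_unique)
  next
    case False
    then have "integral {0..\<tau>} (\<lambda>t. F t c) = integral {0..\<tau>} (\<lambda>t. 0)"
      using s by (intro integral_cong 0) auto
    then show ?thesis using False by simp
  qed
  finally show ?thesis .
qed

text \<open>Per label, \<open>J\<close> is the final value of the test function and \<open>I\<close>
  its change since entrance, so \<open>J - I\<close> is the value at entrance. It holds for almost
  every label only, since Fubini's theorem yields integrable sections almost everywhere.\<close>

lemma weak_identity_\<nu>:
  assumes \<tau>: "\<tau> \<in> {0..T}" and di: "double_integrable \<tau> \<rho> f"
  obtains I J where "integrable \<nu> I" "integrable \<nu> J"
    "(LINT t|lebesgue_on {0<..\<tau>}. LINT x|\<rho> t. f t x) = (LINT c|\<nu>. I c)"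
    "(LINT x|\<rho> \<tau>. \<phi> \<tau> x) = (LINT c|\<nu>. J c)"
    "AE c in \<nu>. \<forall>s\<in>{0..T}. 0 \<le> c + Z s \<and> (s = 0 \<or> c + Z s = 0) \<longrightarrow>
      J c - I c = (if s \<le> \<tau> then \<phi> s (Y c s) else 0)"
proof -
  interpret pair_sigma_finite "lebesgue_on {0<..\<tau>}" \<nu> by (rule sigma_finite_pair)
  interpret N: finite_measure \<nu> by (rule \<nu>_finite)
  have \<tau>T: "\<tau> \<le> T" using \<tau> by auto
  note F_int = integrable_F_if_double_integrable[OF \<tau>T di]
  define I where "I = (\<lambda>c. LINT t|lebesgue_on {0<..\<tau>}. F t c)"
  define J where "J = (\<lambda>c. indicator (A \<tau>) c *\<^sub>R \<phi> \<tau> (c + Z \<tau>))"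
  have \<phi>_cont: "continuous_on {0..1} (\<phi> \<tau>)"
    by (rule DERIV_continuous_on[OF has_derivative_x[OF \<tau>]])
  have clamp_cont: "continuous_on UNIV (\<lambda>x. \<phi> \<tau> (max 0 (min 1 x)))"
    by (rule continuous_on_compose2[OF \<phi>_cont]) (auto intro!: continuous_intros)
  have \<phi>_bound: "\<bar>\<phi> \<tau> x\<bar> \<le> C" if "x \<in> {0..1}" for x
    using lipschitz_x[OF \<tau> that, of 1] zero_right[OF \<tau>] that C(1) mult_left_mono[of "\<bar>x - 1\<bar>" 1 C] by auto
  show thesis
  proof (rule that[of I J])
    show "integrable \<nu> I" unfolding I_def using integrable_snd[OF F_int] .
    have "(LINT t|lebesgue_on {0<..\<tau>}. LINT x|\<rho> t. f t x) = (LINT t|lebesgue_on {0<..\<tau>}. LINT c|\<nu>. F t c)"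
      by (rule Bochner_Integration.integral_cong[OF refl], rule integral_\<rho>_f(1))
        (use \<tau> in \<open>auto simp: space_restrict_space\<close>)
    also have "\<dots> = (LINT c|\<nu>. I c)" unfolding I_def by (rule Fubini_integral[OF F_int, symmetric])
    finally show "(LINT t|lebesgue_on {0<..\<tau>}. LINT x|\<rho> t. f t x) = (LINT c|\<nu>. I c)" .
    have "(\<lambda>x. \<phi> \<tau> (max 0 (min 1 x))) \<in> borel_measurable borel"
      using clamp_cont by (rule borel_measurable_continuous_onI)
    then have "(\<lambda>c. indicator (A \<tau>) c *\<^sub>R \<phi> \<tau> (max 0 (min 1 (c + Z \<tau>)))) \<in> borel_measurable \<nu>"
      by measurable
    moreover have "J = (\<lambda>c. indicator (A \<tau>) c *\<^sub>R \<phi> \<tau> (max 0 (min 1 (c + Z \<tau>))))"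
      by (auto simp: J_def A_def indicator_def)
    ultimately have "J \<in> borel_measurable \<nu>" by simp
    then show "integrable \<nu> J"
      by (rule N.integrable_const_bound[where B = C, rotated])
        (use \<phi>_bound C(1) in \<open>auto simp: J_def A_def indicator_def\<close>)
    show "(LINT x|\<rho> \<tau>. \<phi> \<tau> x) = (LINT c|\<nu>. J c)"
      unfolding J_def
    proof (rule integral_\<rho>[OF \<tau>])
      show "\<phi> \<tau> \<in> borel_measurable (restrict_space borel {0..<1})"
        by (rule borel_measurable_continuous_on_restrict) (rule continuous_on_subset[OF \<phi>_cont], auto)
    qed
    show "AE c in \<nu>. \<forall>s\<in>{0..T}. 0 \<le> c + Z s \<and> (s = 0 \<or> c + Z s = 0) \<longrightarrow>
      J c - I c = (if s \<le> \<tau> then \<phi> s (Y c s) else 0)"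
      using AE_integrable_snd[OF F_int]
    proof eventually_elim
      case (elim c)
      show ?case
      proof (intro ballI impI)
        fix s assume s: "s \<in> {0..T}" "0 \<le> c + Z s \<and> (s = 0 \<or> c + Z s = 0)"
        have I: "I c = (if s \<le> \<tau> then \<phi> \<tau> (Y c \<tau>) - \<phi> s (Y c s) else 0)"
          unfolding I_def using s \<tau> elim by (intro trajectory_lebesgue_integral) auto
        have J: "J c = (if s \<le> \<tau> then \<phi> \<tau> (Y c \<tau>) else 0)"
        proof (cases "s \<le> \<tau>")
          case True
          then have "0 \<le> c + Z \<tau>" using Z_mono[of s \<tau>] s \<tau> by auto
          then show ?thesis using True zero_right[OF \<tau>] by (auto simp: J_def A_def Y_def indicator_def)
        next
          case False
          then have "c + Z \<tau> < 0" using Z_strict_mono[of \<tau> s] s \<tau> by auto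
          then show ?thesis using False by (auto simp: J_def A_def)
        qed
        show "J c - I c = (if s \<le> \<tau> then \<phi> s (Y c s) else 0)" unfolding I J by simp
      qed
    qed
  qed
qed

end

section \<open>From Lagrangian to weak solutions\<close>

lemma space_finite_borel_measures: "M \<in> finite_borel_measures I \<Longrightarrow> space M = I"
  using sets_eq_imp_space_eq[of M "restrict_space borel I"]
  by (simp add: finite_borel_measures_def space_restrict_space)

lemma borel_measurable_finite_borel_measures:
  assumes "M \<in> finite_borel_measures I" "g \<in> borel_measurable borel"
  shows "g \<in> borel_measurable M"
proof -
  have "sets M = sets (restrict_space borel I)" using assms(1) by (simp add: finite_borel_measures_def)
  then show ?thesis
    by (rule measurable_cong_sets[OF _ refl, THEN equalityD2, THEN subsetD])
      (rule measurable_restrict_space1[OF assms(2)])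
qed

lemma absolutely_continuous_fun_on_subinterval:
  assumes "absolutely_continuous_fun_on l r f" "l \<le> l'" "r' \<le> r"
  shows "absolutely_continuous_fun_on l' r' f"
  unfolding absolutely_continuous_fun_on_def
proof (intro allI impI)
  fix \<epsilon> :: real assume "0 < \<epsilon>"
  define P where "P = (\<lambda>l r \<delta>. \<forall>(n::nat) a b.
        (\<forall>i<n. l \<le> a i \<and> a i \<le> b i \<and> b i \<le> r) \<and>
        (\<forall>i<n. \<forall>j<n. i \<noteq> j \<longrightarrow> {a i<..<b i} \<inter> {a j<..<b j} = {}) \<and>
        (\<Sum>i<n. b i - a i) < \<delta>
        \<longrightarrow> (\<Sum>i<n. \<bar>f (b i) - f (a i)\<bar>) < \<epsilon>)"
  have "P l r \<delta> \<Longrightarrow> P l' r' \<delta>" for \<delta>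
    unfolding P_def by (intro allI impI, elim allE impE, rule conjI) (use assms(2,3) in \<open>auto intro: order_trans\<close>)
  moreover have "\<exists>\<delta>>0. P l r \<delta>"
    using assms(1)[unfolded absolutely_continuous_fun_on_def, rule_format, OF \<open>0 < \<epsilon>\<close>] unfolding P_def .
  ultimately have "\<exists>\<delta>>0. P l' r' \<delta>" by blast
  then show "\<exists>\<delta>>0. \<forall>(n::nat) a b.
        (\<forall>i<n. l' \<le> a i \<and> a i \<le> b i \<and> b i \<le> r') \<and>
        (\<forall>i<n. \<forall>j<n. i \<noteq> j \<longrightarrow> {a i<..<b i} \<inter> {a j<..<b j} = {}) \<and>
        (\<Sum>i<n. b i - a i) < \<delta>
        \<longrightarrow> (\<Sum>i<n. \<bar>f (b i) - f (a i)\<bar>) < \<epsilon>" unfolding P_def .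
qed

lemma AE_lebesgue_onE:
  assumes "AE t in lebesgue_on S. P t" "S \<in> sets lebesgue"
  obtains N where "negligible N" "\<forall>t\<in>S - N. P t"
proof -
  have "AE t in lebesgue. t \<in> S \<longrightarrow> P t" using assms by (simp add: AE_restrict_space_iff)
  then obtain N where "N \<in> null_sets lebesgue" "{t \<in> space lebesgue. \<not> (t \<in> S \<longrightarrow> P t)} \<subseteq> N"
    by (auto simp: eventually_ae_filter)
  then show thesis by (intro that[of N]) (auto simp: negligible_iff_null_sets)
qed

text \<open>A non-integrable function has integral \<open>0\<close>, so the bound applies to
  integrands whose measurability has not yet been established, such as indicators composed with the
  semiflow.\<close>

lemma (in finite_measure) integral_le_measure_space:
  fixes f :: "'a \<Rightarrow> real"
  assumes "\<And>x. f x \<le> 1"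
  shows "(LINT x|M. f x) \<le> measure M (space M)"
proof (cases "integrable M f")
  case True
  then have "(LINT x|M. f x) \<le> (LINT x|M. 1)" using assms by (intro integral_mono) auto
  then show ?thesis by simp
qed (simp add: not_integrable_integral_eq)

text \<open>The increments do not depend on the starting time and point, which makes all
  characteristics translates of one another.\<close>

lemma semiflow_has_integral:
  assumes X: "semiflow T (\<lambda>t x. V t) X" and "0 \<le> r" "r \<le> s" "s \<le> t" "t \<le> T" "0 \<le> x"
  shows "(V has_integral (X t r x - X s r x)) {s..t}"
proof -
  have r: "r \<in> {0..T}" using assms by auto
  have AC: "absolutely_continuous_fun_on r T (\<lambda>t. X t r x)"
    and AE: "AE t in lebesgue_on {r..T}. ((\<lambda>s. X s r x) has_real_derivative V t) (at t within {r..T})"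
    using X r \<open>0 \<le> x\<close> unfolding semiflow_def by blast+
  obtain N where N: "negligible N" "\<forall>t\<in>{r..T} - N. ((\<lambda>s. X s r x) has_real_derivative V t) (at t within {r..T})"
    by (rule AE_lebesgue_onE[OF AE]) auto
  show ?thesis
  proof (rule has_integral_derivative_absolutely_continuous[OF \<open>s \<le> t\<close> N(1)])
    fix y assume "y \<in> {s..t}" "y \<notin> N"
    then have "((\<lambda>s. X s r x) has_real_derivative V y) (at y within {r..T})"
      using N(2) assms by auto
    then show "((\<lambda>s. X s r x) has_real_derivative V y) (at y within {s..t})"
      by (rule has_field_derivative_subset) (use assms in auto)
  qed (rule absolutely_continuous_fun_on_subinterval[OF AC], use assms in auto)
qed

lemma (in transport_flow) lagrangian_pushforward:
  assumes Z_meas [measurable]: "Z \<in> borel_measurable borel"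
    and \<rho>0: "\<rho>0 \<in> finite_borel_measures {0..<1}" and \<mu>: "\<mu> \<in> finite_borel_measures {0<..T}"
    and R: "R \<in> finite_borel_measures {0..<1}" and t: "t \<in> {0..T}"
    and eq: "\<And>E. E \<in> sets borel \<Longrightarrow> E \<subseteq> {0..<1} \<Longrightarrow> measure R E =
      (LINT x|\<rho>0. indicator E (x + Z t)) + (LINT s:{0<..t}|\<mu>. indicator E (Z t - Z s))"
  shows "R = distr (restrict_space (sum_measure (distr \<rho>0 borel (\<lambda>x. x)) (distr \<mu> borel (\<lambda>s. - Z s)))
    {c. 0 \<le> c + Z t \<and> c + Z t < 1}) (restrict_space borel {0..<1}) (\<lambda>c. c + Z t)"
    (is "_ = distr (restrict_space ?\<nu> ?A) _ _")
proof (rule measure_eqI)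
  interpret R: finite_measure R using R by (simp add: finite_borel_measures_def)
  interpret \<rho>0: finite_measure \<rho>0 using \<rho>0 by (simp add: finite_borel_measures_def)
  interpret \<mu>: finite_measure \<mu> using \<mu> by (simp add: finite_borel_measures_def)
  have sets: "sets R = sets (restrict_space borel {0..<1})" "sets \<rho>0 = sets (restrict_space borel {0..<1})"
    "sets \<mu> = sets (restrict_space borel {0<..T})"
    using R \<rho>0 \<mu> by (auto simp: finite_borel_measures_def)
  have space: "space \<rho>0 = {0..<1}" "space \<mu> = {0<..T}"
    using \<rho>0 \<mu> by (simp_all add: space_finite_borel_measures)
  have id0: "(\<lambda>x. x) \<in> borel_measurable \<rho>0"
    by (rule borel_measurable_finite_borel_measures[OF \<rho>0]) simp
  have id\<mu>: "(\<lambda>s. - Z s) \<in> borel_measurable \<mu>"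
    by (rule borel_measurable_finite_borel_measures[OF \<mu>]) simp
  have A: "?A \<in> sets borel" by measurable
  have shift: "(\<lambda>c. c + Z t) \<in> measurable (restrict_space ?\<nu> ?A) (restrict_space borel {0..<1})"
  proof (rule measurable_restrict_space2)
    have "(\<lambda>c. c + Z t) \<in> borel_measurable ?\<nu>" by simp
    then show "(\<lambda>c. c + Z t) \<in> borel_measurable (restrict_space ?\<nu> ?A)" by (rule measurable_restrict_space1)
  qed (auto simp: space_restrict_space)
  show "sets R = sets (distr (restrict_space ?\<nu> ?A) (restrict_space borel {0..<1}) (\<lambda>c. c + Z t))"
    using sets by simp
  fix B assume "B \<in> sets R"
  then have B: "B \<in> sets borel" "B \<subseteq> {0..<1}" and B': "B \<in> sets (restrict_space borel {0..<1})"
    using sets by (auto simp: sets_restrict_space)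
  define B\<^sub>0 where "B\<^sub>0 = {c. c + Z t \<in> B}"
  have "(\<lambda>c. c + Z t) \<in> borel_measurable borel" by simp
  from measurable_sets[OF this B(1)] have B0: "B\<^sub>0 \<in> sets borel" by (simp add: B\<^sub>0_def vimage_def)
  have "emeasure (distr (restrict_space ?\<nu> ?A) (restrict_space borel {0..<1}) (\<lambda>c. c + Z t)) B
    = emeasure (restrict_space ?\<nu> ?A) ((\<lambda>c. c + Z t) -` B \<inter> space (restrict_space ?\<nu> ?A))"
    by (rule emeasure_distr[OF shift B'])
  also have "(\<lambda>c. c + Z t) -` B \<inter> space (restrict_space ?\<nu> ?A) = B\<^sub>0"
    using B(2) by (auto simp: space_restrict_space B\<^sub>0_def)
  also have "emeasure (restrict_space ?\<nu> ?A) B\<^sub>0 = emeasure ?\<nu> B\<^sub>0"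
    by (rule emeasure_restrict_space) (use A B(2) in \<open>auto simp: B\<^sub>0_def\<close>)
  also have "\<dots> = emeasure \<rho>0 (B\<^sub>0 \<inter> space \<rho>0) + emeasure \<mu> ((\<lambda>s. - Z s) -` B\<^sub>0 \<inter> space \<mu>)"
    using B0 by (simp add: emeasure_sum_measure emeasure_distr[OF id0] emeasure_distr[OF id\<mu>])
  also have "\<dots> = ennreal (measure \<rho>0 (B\<^sub>0 \<inter> space \<rho>0) + measure \<mu> ((\<lambda>s. - Z s) -` B\<^sub>0 \<inter> space \<mu>))"
    by (simp add: \<rho>0.emeasure_eq_measure \<mu>.emeasure_eq_measure)
  also have "measure \<rho>0 (B\<^sub>0 \<inter> space \<rho>0) = (LINT x|\<rho>0. indicator B\<^sub>0 x)" by simp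
  also have "\<dots> = (LINT x|\<rho>0. indicator B (x + Z t))" by (simp add: B\<^sub>0_def indicator_def)
  also have "measure \<mu> ((\<lambda>s. - Z s) -` B\<^sub>0 \<inter> space \<mu>) = (LINT s|\<mu>. indicator ((\<lambda>s. - Z s) -` B\<^sub>0) s)" by simp
  also have "\<dots> = (LINT s:{0<..t}|\<mu>. indicator B (Z t - Z s))"
    unfolding set_lebesgue_integral_def
  proof (rule Bochner_Integration.integral_cong[OF refl])
    fix s assume "s \<in> space \<mu>"
    then have s: "s \<in> {0<..T}" by (simp add: space)
    \<comment> \<open>Particles entering after \<open>t\<close> would sit at a negative position,
      outside \<open>B\<close>. Hence the labels of the entire influx can be kept in one measure
      that serves all times.\<close>
    then have "s \<le> t" if "Z t - Z s \<in> B"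
      using that B(2) Z_le_iff[of s t] t by auto
    then show "indicator ((\<lambda>s. - Z s) -` B\<^sub>0) s = indicator {0<..t} s *\<^sub>R (indicator B (Z t - Z s) :: real)"
      using s by (auto simp: indicator_def B\<^sub>0_def)
  qed
  also have "ennreal ((LINT x|\<rho>0. indicator B (x + Z t)) + (LINT s:{0<..t}|\<mu>. indicator B (Z t - Z s))) = ennreal (measure R B)"
    using eq[OF B] by simp
  finally show "emeasure R B = emeasure (distr (restrict_space ?\<nu> ?A) (restrict_space borel {0..<1}) (\<lambda>c. c + Z t)) B"
    by (simp add: R.emeasure_eq_measure)
qed

text \<open>The entrance values are integrated separately over the two populations of labels: the
  first gives the initial term, the second the boundary term.\<close>

lemma (in transported_measure) weak_identity:
  assumes \<rho>0: "\<rho>0 \<in> finite_borel_measures {0..<1}" and \<mu>: "\<mu> \<in> finite_borel_measures {0<..T}"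
    and \<nu>: "\<nu> = sum_measure (distr \<rho>0 borel (\<lambda>x. x)) (distr \<mu> borel (\<lambda>s. - Z s))"
    and \<tau>: "\<tau> \<in> {0..T}" and di: "double_integrable \<tau> \<rho> f"
  shows "0 = (LINT t|lebesgue_on {0<..\<tau>}. LINT x|\<rho> t. f t x) + (LINT t:{0<..\<tau>}|\<mu>. \<phi> t 0)
    - (LINT x|\<rho> \<tau>. \<phi> \<tau> x) + (LINT x|\<rho>0. \<phi> 0 x)"
proof -
  let ?\<nu>1 = "distr \<rho>0 borel (\<lambda>x. x)" and ?\<nu>2 = "distr \<mu> borel (\<lambda>s. - Z s)"
  have sets: "sets \<rho>0 = sets (restrict_space borel {0..<1})" "sets \<mu> = sets (restrict_space borel {0<..T})"
    using \<rho>0 \<mu> by (auto simp: finite_borel_measures_def)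
  have space: "space \<rho>0 = {0..<1}" "space \<mu> = {0<..T}"
    using \<rho>0 \<mu> by (simp_all add: space_finite_borel_measures)
  have id0: "(\<lambda>x. x) \<in> borel_measurable \<rho>0"
    by (rule borel_measurable_finite_borel_measures[OF \<rho>0]) simp
  have id\<mu>: "(\<lambda>s. - Z s) \<in> borel_measurable \<mu>"
    by (rule borel_measurable_finite_borel_measures[OF \<mu>]) simp
  obtain I J where IJ: "integrable \<nu> I" "integrable \<nu> J"
    "(LINT t|lebesgue_on {0<..\<tau>}. LINT x|\<rho> t. f t x) = (LINT c|\<nu>. I c)"
    "(LINT x|\<rho> \<tau>. \<phi> \<tau> x) = (LINT c|\<nu>. J c)"
    and AE: "AE c in \<nu>. \<forall>s\<in>{0..T}. 0 \<le> c + Z s \<and> (s = 0 \<or> c + Z s = 0) \<longrightarrow>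
      J c - I c = (if s \<le> \<tau> then \<phi> s (Y c s) else 0)"
    by (rule weak_identity_\<nu>[OF \<tau> di])
  define K where "K = (\<lambda>c. J c - I c)"
  have K: "integrable \<nu> K" unfolding K_def using IJ by simp
  then have K_meas: "K \<in> borel_measurable borel"
    using measurable_cong_sets[OF \<nu>_sets refl] by blast
  have "(LINT c|\<nu>. J c) - (LINT c|\<nu>. I c) = (LINT c|\<nu>. K c)"
    unfolding K_def using IJ by simp
  also have "\<dots> = (LINT c|?\<nu>1. K c) + (LINT c|?\<nu>2. K c)"
    using K unfolding \<nu> by (intro integral_sum_measure) auto
  also have "(LINT c|?\<nu>1. K c) = (LINT x|\<rho>0. K x)" by (rule integral_distr[OF id0 K_meas])
  also have "\<dots> = (LINT x|\<rho>0. \<phi> 0 x)"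
  proof (rule integral_cong_AE)
    show "K \<in> borel_measurable \<rho>0"
      using measurable_compose[OF id0 K_meas] by simp
    have "continuous_on {0..1} (\<phi> 0)"
      by (rule DERIV_continuous_on[OF has_derivative_x]) (use T_pos in auto)
    then have "continuous_on {0..<1} (\<phi> 0)" by (rule continuous_on_subset) auto
    then show "\<phi> 0 \<in> borel_measurable \<rho>0"
      unfolding measurable_cong_sets[OF sets(1) refl] by (rule borel_measurable_continuous_on_restrict)
    have "AE c in ?\<nu>1. \<forall>s\<in>{0..T}. 0 \<le> c + Z s \<and> (s = 0 \<or> c + Z s = 0) \<longrightarrow>
      J c - I c = (if s \<le> \<tau> then \<phi> s (Y c s) else 0)"
      using AE unfolding \<nu> by (rule AE_sum_measureD[rotated]) simp
    from AE_distrD[OF id0 this] AE_space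
    show "AE x in \<rho>0. K x = \<phi> 0 x"
    proof eventually_elim
      case (elim x)
      \<comment> \<open>An initial particle enters at time \<open>0\<close>, where
        \<open>Y x 0 = x\<close>.\<close>
      then have "J x - I x = (if 0 \<le> \<tau> then \<phi> 0 (Y x 0) else 0)"
        using T_pos by (intro elim(1)[rule_format]) (auto simp: space Z0)
      then show ?case using elim(2) \<tau> by (auto simp: K_def space Z0 Y_def)
    qed
  qed
  also have "(LINT c|?\<nu>2. K c) = (LINT s|\<mu>. K (- Z s))" by (rule integral_distr[OF id\<mu> K_meas])
  also have "\<dots> = (LINT t:{0<..\<tau>}|\<mu>. \<phi> t 0)"
    unfolding set_lebesgue_integral_def
  proof (rule integral_cong_AE)
    show "(\<lambda>s. K (- Z s)) \<in> borel_measurable \<mu>"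
      by (rule measurable_compose[OF id\<mu> K_meas])
    obtain L where "L-lipschitz_on {0..T} (\<lambda>t. \<phi> t 0)" using lipschitz_t[of 0] by auto
    then have "continuous_on {0..T} (\<lambda>t. \<phi> t 0)" by (rule lipschitz_on_continuous_on)
    then have "continuous_on {0<..T} (\<lambda>t. \<phi> t 0)" by (rule continuous_on_subset) auto
    then have "(\<lambda>t. \<phi> t 0) \<in> borel_measurable (restrict_space borel {0<..T})"
      by (rule borel_measurable_continuous_on_restrict)
    moreover have "indicat_real {0<..\<tau>} \<in> borel_measurable (restrict_space borel {0<..T})"
      by (rule measurable_restrict_space1) simp
    ultimately show "(\<lambda>t. indicat_real {0<..\<tau>} t *\<^sub>R \<phi> t 0) \<in> borel_measurable \<mu>"
      unfolding measurable_cong_sets[OF sets(2) refl] by simp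
    have "AE c in ?\<nu>2. \<forall>s\<in>{0..T}. 0 \<le> c + Z s \<and> (s = 0 \<or> c + Z s = 0) \<longrightarrow>
      J c - I c = (if s \<le> \<tau> then \<phi> s (Y c s) else 0)"
      using AE unfolding \<nu> by (rule AE_sum_measureD[rotated]) simp
    from AE_distrD[OF id\<mu> this] AE_space
    show "AE s in \<mu>. K (- Z s) = indicat_real {0<..\<tau>} s *\<^sub>R \<phi> s 0"
    proof eventually_elim
      case (elim s)
      \<comment> \<open>An influx particle has \<open>- Z s + Z s = 0\<close>, so it enters at time
        \<open>s\<close> in position \<open>0\<close>.\<close>
      then have "J (- Z s) - I (- Z s) = (if s \<le> \<tau> then \<phi> s (Y (- Z s) s) else 0)"
        by (intro elim(1)[rule_format]) (auto simp: space)
      then show ?case using elim(2) by (auto simp: K_def space Y_def indicator_def)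
    qed
  qed
  finally show ?thesis using IJ(3,4) by simp
qed

theorem theorem4p3:
  fixes \<alpha> :: "real \<Rightarrow> real" and T :: real
    and \<rho>0 \<mu> :: "real measure" and \<rho> :: "real \<Rightarrow> real measure"
  assumes "\<alpha> ` {0..} \<subseteq> {0<..1}" and "strict_antimono_on {0..} \<alpha>"
    and "\<exists>L. L-lipschitz_on {0..} \<alpha>" and "\<alpha> 0 = 1"
    and "T > 0"
    and "\<rho>0 \<in> finite_borel_measures {0..<1}" and "\<mu> \<in> finite_borel_measures {0<..T}"
    and "zero_singular_continuous_part \<rho>0" and "zero_singular_continuous_part \<mu>"
    and "lagrangian_solution \<alpha> T \<rho>0 \<mu> \<rho>"
  shows "weak_solution \<alpha> T \<rho>0 \<mu> \<rho>"
proof -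
  define V where "V = (\<lambda>t. \<alpha> (total_mass \<rho> t))"
  obtain X where X: "semiflow T (\<lambda>t x. V t) X"
    and \<rho>_eq: "\<forall>t\<in>{0..T}. \<forall>E\<in>sets borel. E \<subseteq> {0..<1} \<longrightarrow> measure (\<rho> t) E =
      (LINT x|\<rho>0. indicator E (X t 0 x)) + (LINT s:{0<..t}|\<mu>. indicator E (X t s 0))"
    using assms(10) unfolding lagrangian_solution_def V_def by blast
  have \<rho>: "\<forall>t\<in>{0..T}. \<rho> t \<in> finite_borel_measures {0..<1}"
    and W_meas: "total_mass \<rho> \<in> borel_measurable (lebesgue_on {0..T})"
    using assms(10) unfolding lagrangian_solution_def by blast+
  interpret \<rho>0: finite_measure \<rho>0 using assms(6) by (simp add: finite_borel_measures_def)
  interpret \<mu>: finite_measure \<mu> using assms(7) by (simp add: finite_borel_measures_def)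
  \<comment> \<open>All mass that is ever present: the initial mass and the whole influx.\<close>
  define m where "m = measure \<rho>0 (space \<rho>0) + measure \<mu> (space \<mu>)"
  have W_le: "total_mass \<rho> t \<le> m" if "t \<in> {0..T}" for t
  proof -
    have "total_mass \<rho> t = (LINT x|\<rho>0. indicator {0..<1} (X t 0 x)) + (LINT s:{0<..t}|\<mu>. indicator {0..<1} (X t s 0))"
      using \<rho>_eq that by auto
    also have "\<dots> \<le> m"
      unfolding m_def set_lebesgue_integral_def
      by (intro add_mono \<rho>0.integral_le_measure_space \<mu>.integral_le_measure_space) (auto simp: indicator_def)
    finally show ?thesis .
  qed
  \<comment> \<open>The slowest possible speed, as the total mass is at most \<open>m\<close> and
    \<open>\<alpha>\<close> decreases.\<close>
  define c0 where "c0 = \<alpha> m"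
  have m: "0 \<le> m" by (simp add: m_def)
  then have c0: "0 < c0" using assms(1) by (auto simp: c0_def)
  have V_le: "V t \<le> 1" for t
  proof -
    have "\<alpha> (total_mass \<rho> t) \<in> \<alpha> ` {0..}" by (intro imageI) simp
    then have "\<alpha> (total_mass \<rho> t) \<in> {0<..1}" using assms(1) by blast
    then show ?thesis by (simp add: V_def)
  qed
  have V_ge: "c0 \<le> V t" if "t \<in> {0..T}" for t
  proof (cases "total_mass \<rho> t = m")
    case False
    then have "total_mass \<rho> t < m" using W_le[OF that] by simp
    then have "\<alpha> m < \<alpha> (total_mass \<rho> t)"
      using assms(2) m by (auto simp: monotone_on_def)
    then show ?thesis by (simp add: c0_def V_def)
  qed (simp add: c0_def V_def)
  \<comment> \<open>Clamping time gives control of \<open>Z\<close> on all of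
    \<open>\<real>\<close>, where Borel measurability is required.\<close>
  define Z where "Z = (\<lambda>t. X (max 0 (min T t)) 0 0)"
  have Z_eq: "Z t = X t 0 0" if "t \<in> {0..T}" for t using that by (simp add: Z_def)
  have X_init: "X r r x = x" if "r \<in> {0..T}" "0 \<le> x" for r x
    using X that by (auto simp: semiflow_def)
  have Z_int: "(V has_integral (Z t - Z s)) {s..t}" if "0 \<le> s" "s \<le> t" "t \<le> T" for s t
    using semiflow_has_integral[OF X, of 0 s t 0] that by (simp add: Z_eq)
  have X_eq: "X t r x = x + Z t - Z r" if "0 \<le> r" "r \<le> t" "t \<le> T" "0 \<le> x" for t r x
  proof -
    have "(V has_integral (X t r x - x)) {r..t}"
      using semiflow_has_integral[OF X, of r r t x] that X_init[of r x] by simp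
    from has_integral_unique[OF this Z_int[OF that(1-3)]] show ?thesis by simp
  qed
  have "AE t in lebesgue_on {0..T}. ((\<lambda>s. X s 0 0) has_real_derivative V t) (at t within {0..T})"
    using X assms(5) unfolding semiflow_def by auto
  then obtain N where N: "negligible N" "\<forall>t\<in>{0..T} - N. ((\<lambda>s. X s 0 0) has_real_derivative V t) (at t within {0..T})"
    by (rule AE_lebesgue_onE) auto
  interpret transport_flow T Z V c0 N
  proof
    show "Z 0 = 0" using X_init[of 0 0] assms(5) by (simp add: Z_eq)
    show "c0 * (t - s) \<le> Z t - Z s" if "0 \<le> s" "s \<le> t" "t \<le> T" for s t
      using has_integral_le[OF has_integral_const_real[of c0 s t] Z_int[OF that]] V_ge that
      by (simp add: mult.commute)
    show "Z t - Z s \<le> t - s" if "0 \<le> s" "s \<le> t" "t \<le> T" for s t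
      using has_integral_le[OF Z_int[OF that] has_integral_const_real[of 1 s t]] V_le that by simp
    show "(Z has_real_derivative V t) (at t within {0..T})" if "t \<in> {0..T}" "t \<notin> N" for t
      by (rule has_field_derivative_transform_within[of "\<lambda>s. X s 0 0" _ _ _ 1]) (use N that Z_eq in auto)
  qed (fact c0, fact N(1))
  have "continuous_on {0..T} Z"
    by (rule lipschitz_on_continuous_on[of 1], rule lipschitz_onI) (use Z_lipschitz in \<open>auto simp: dist_real_def\<close>)
  then have "continuous_on UNIV (\<lambda>t. Z (max 0 (min T t)))"
    by (rule continuous_on_compose2) (use assms(5) in \<open>auto intro!: continuous_intros\<close>)
  moreover have "(\<lambda>t. Z (max 0 (min T t))) = Z" using assms(5) by (auto simp: Z_def)
  ultimately have Z_meas: "Z \<in> borel_measurable borel"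
    using borel_measurable_continuous_onI by metis
  obtain L where "L-lipschitz_on {0..} \<alpha>" using assms(3) by blast
  then have "continuous_on {0..} \<alpha>" by (rule lipschitz_on_continuous_on)
  \<comment> \<open>A continuous extension of \<open>\<alpha>\<close> to the real line; it changes
    nothing at total masses, which are nonnegative.\<close>
  then have "continuous_on UNIV (\<lambda>x. \<alpha> (max 0 x))"
    by (rule continuous_on_compose2) (auto intro!: continuous_intros)
  from measurable_compose[OF W_meas borel_measurable_continuous_onI[OF this]]
  have V_meas: "V \<in> borel_measurable (lebesgue_on {0..T})" by (simp add: V_def)
  define \<nu> where "\<nu> = sum_measure (distr \<rho>0 borel (\<lambda>x. x)) (distr \<mu> borel (\<lambda>s. - Z s))"
  have \<nu>_sets: "sets \<nu> = sets borel" by (simp add: \<nu>_def)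
  have "finite_measure (distr \<rho>0 borel (\<lambda>x. x))" "finite_measure (distr \<mu> borel (\<lambda>s. - Z s))"
    using Z_meas by (auto intro!: \<rho>0.finite_measure_distr \<mu>.finite_measure_distr
        borel_measurable_finite_borel_measures[OF assms(6)] borel_measurable_finite_borel_measures[OF assms(7)])
  from finite_measure.emeasure_finite[OF this(1), of UNIV] finite_measure.emeasure_finite[OF this(2), of UNIV]
  have \<nu>_fin: "finite_measure \<nu>"
    unfolding \<nu>_def by (intro finite_measureI) (simp add: emeasure_sum_measure)
  have push: "\<rho> t = distr (restrict_space \<nu> {c. 0 \<le> c + Z t \<and> c + Z t < 1}) (restrict_space borel {0..<1}) (\<lambda>c. c + Z t)"
    if t: "t \<in> {0..T}" for t
    unfolding \<nu>_def
  proof (rule lagrangian_pushforward[OF Z_meas assms(6,7) _ t])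
    fix E :: "real set" assume E: "E \<in> sets borel" "E \<subseteq> {0..<1}"
    have "measure (\<rho> t) E = (LINT x|\<rho>0. indicator E (X t 0 x)) + (LINT s:{0<..t}|\<mu>. indicator E (X t s 0))"
      using \<rho>_eq t E by blast
    also have "(LINT x|\<rho>0. indicator E (X t 0 x)) = (LINT x|\<rho>0. indicat_real E (x + Z t))"
    proof (rule Bochner_Integration.integral_cong[OF refl])
      fix x assume "x \<in> space \<rho>0"
      then have "x \<in> {0..<1}" using space_finite_borel_measures[OF assms(6)] by simp
      then show "indicat_real E (X t 0 x) = indicat_real E (x + Z t)" using t by (simp add: X_eq Z0)
    qed
    also have "(LINT s:{0<..t}|\<mu>. indicator E (X t s 0)) = (LINT s:{0<..t}|\<mu>. indicat_real E (Z t - Z s))"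
      unfolding set_lebesgue_integral_def
      by (rule Bochner_Integration.integral_cong[OF refl]) (use t in \<open>auto simp: indicator_def X_eq\<close>)
    finally show "measure (\<rho> t) E = (LINT x|\<rho>0. indicator E (x + Z t)) + (LINT s:{0<..t}|\<mu>. indicator E (Z t - Z s))" .
  qed (use \<rho> t in blast)
  have W_int: "integrable (lebesgue_on {0..T}) (total_mass \<rho>)"
  proof (rule finite_measure.integrable_const_bound[OF _ _ W_meas])
    show "finite_measure (lebesgue_on {0..T})" by (intro finite_measure_lebesgue_on) simp
    show "AE t in lebesgue_on {0..T}. norm (total_mass \<rho> t) \<le> m"
      using W_le by (intro AE_I2) (simp add: space_restrict_space)
  qed
  show ?thesis
    unfolding weak_solution_def
  proof (intro conjI ballI \<rho> W_int)
    fix \<tau> \<phi> assume \<tau>: "\<tau> \<in> {0..T}" and \<phi>: "\<phi> \<in> test_functions T"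
    interpret \<nu>: finite_measure \<nu> by (rule \<nu>_fin)
    interpret transported_measure T \<phi> Z V c0 N \<nu> \<rho> \<alpha>
    proof unfold_locales
      show "\<bar>V t\<bar> \<le> 1" if "t \<in> {0..T}" for t using V_le[of t] V_ge[OF that] c0 by linarith
      show "V t = \<alpha> (total_mass \<rho> t)" for t by (simp add: V_def)
    qed (rule assms(5) \<phi> \<nu>_sets Z_meas V_meas push | assumption)+
    show "AE t in lebesgue_on {0<..\<tau>}. AE x in \<rho> t. (\<lambda>s. \<phi> s x) differentiable (at t within {0..T})"
      using AE_differentiable[of \<tau>] \<tau> by (simp add: eventually_mono)
    show "(\<exists>L. \<forall>x\<in>{0..<1}. L-lipschitz_on {0..T} (\<lambda>t. \<phi> t x)) \<longrightarrow>
        double_integrable \<tau> \<rho> (transport_derivative \<alpha> T \<rho> \<phi>)"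
      using double_integrable_if_uniformly_lipschitz[of \<tau>, unfolded f_def] \<tau> by fastforce
    show "double_integrable \<tau> \<rho> (transport_derivative \<alpha> T \<rho> \<phi>) \<longrightarrow>
        0 = (LINT t|lebesgue_on {0<..\<tau>}. (LINT x|\<rho> t.
               partial_t T \<phi> t x + \<alpha> (total_mass \<rho> t) * partial_x \<phi> t x))
            + (LINT t:{0<..\<tau>}|\<mu>. \<phi> t 0) - (LINT x|\<rho> \<tau>. \<phi> \<tau> x) + (LINT x|\<rho>0. \<phi> 0 x)"
      using weak_identity[OF assms(6,7) \<nu>_def \<tau>] unfolding f_def transport_derivative_def by (rule impI)
  qed (use \<rho> in blast)
qed

end
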